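(* Let $X$ be a Hilbert $C^*$-module over a $C^*$-algebra $\mathsf{A}$ and let $(x_n)_n$ be a frame or an outer frame for $X$ with analysis operator $U$. An operator $V\in\mathbb{B}(X,\ell^2(\mathsf{A}))$ is the analysis operator of a frame or an outer frame dual to $(x_n)_n$ if and only if $V$ is of the form $$V=F^*U(U^*U)^{-1},$$ where $F\in\mathbb{B}(\ell^2(\mathsf{A}))$ is an oblique projection to $\mathrm{R}(U)$ along some closed direct complement of $\mathrm{R}(U)$ in $\ell^2(\mathsf{A})$.
   Context: $\mathsf{A}$ is an arbitrary $C^*$-algebra (not necessarily unital) with multiplier algebra $M(\mathsf{A})$. Hilbert $\mathsf{A}$-modules are right modules with inner product $\mathsf{A}$-linear in the second variable; they are not assumed full. $\mathbb{B}(X,Y)$ denotes the adjointable operators from $X$ to $Y$, $\mathbb{B}(X)=\mathbb{B}(X,X)$, and $\mathrm{R}(T)$ is the range of $T$. $\ell^2(\mathsf{A})$ is the Hilbert $\mathsf{A}$-module of sequences $(a_n)_n$ in $\mathsf{A}$ with $\sum_n a_n^*a_n$ norm convergent, with inner product $\langle (a_n)_n,(b_n)_n\rangle=\sum_n a_n^*b_n$. $M(X)$ denotes the multiplier module of $X$: $M(X)=\mathbb{B}(\mathsf{A},X)$, a Hilbert $M(\mathsf{A})$-module with $\langle v,w\rangle=v^*w\in\mathbb{B}(\mathsf{A})=M(\mathsf{A})$, containing $X$ via $x\mapsto(a\mapsto xa)$, and $M(X)\mathsf{A}=X$; thus $\langle v,x\rangle\in\mathsf{A}$ for $v\in M(X)$,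 $x\in X$. All sequences are infinite, indexed by $\mathbb{N}$. A sequence $(x_n)_n$ in $X$ is a frame for $X$ if there are constants $A,B>0$ with $A\langle x,x\rangle\le\sum_{n=1}^\infty\langle x,x_n\rangle\langle x_n,x\rangle\le B\langle x,x\rangle$ for all $x\in X$, the series converging in norm. A sequence $(x_n)_n$ in $M(X)$ is an outer frame for $X$ if $x_n\in M(X)\setminus X$ for at least one $n$ and the same inequalities hold for all $x\in X$ (with norm convergence in $\mathsf{A}$) for some $A,B>0$. The analysis operator of a frame or outer frame $(x_n)_n$ is $U\in\mathbb{B}(X,\ell^2(\mathsf{A}))$, $Ux=(\langle x_n,x\rangle)_n$; its adjoint is $U^*((a_n)_n)=\sum_{n=1}^\infty x_na_n$; $\mathrm{R}(U)$ is closed and $U^*U$ is invertible in $\mathbb{B}(X)$. A frame or outer frame $(y_n)_n$ for $X$ is dual to $(x_n)_n$ if $\sum_{n=1}^\infty y_n\langle x_n,x\rangle=x$ for all $x\in X$ (norm convergence). If $\ell^2(\mathsf{A})=Y\dotplus Z$ is an (algebraic, not necessarily orthogonal) direct sum of closed submodules, the oblique projection to $Y$ along $Z$ is the map $y+z\mapsto y$ ($y\in Y,z\in Z$). *)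

theory Defs
  imports "HOL-Analysis.Analysis" "HOL-Library.Function_Algebras"
begin

section \<open>Complex vector spaces and C*-algebras\<close>

class complex_vector = ab_group_add +
  fixes scaleC :: "complex \<Rightarrow> 'a \<Rightarrow> 'a"  (infixr "*\<^sub>C" 75)
  assumes scaleC_add_right: "c *\<^sub>C (x + y) = c *\<^sub>C x + c *\<^sub>C y"
    and scaleC_add_left: "(c + d) *\<^sub>C x = c *\<^sub>C x + d *\<^sub>C x"
    and scaleC_scaleC: "c *\<^sub>C (d *\<^sub>C x) = (c * d) *\<^sub>C x"
    and scaleC_one: "1 *\<^sub>C x = x"

instantiation "fun" :: (type, complex_vector) complex_vector
begin

definition scaleC_fun :: "complex \<Rightarrow> ('a \<Rightarrow> 'b) \<Rightarrow> 'a \<Rightarrow> 'b"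
  where "scaleC_fun c f = (\<lambda>i. c *\<^sub>C f i)"

instance
  by standard (auto simp: scaleC_fun_def fun_eq_iff scaleC_add_right scaleC_add_left
      scaleC_scaleC scaleC_one)

end

text \<open>C*-algebras; \<^class>\<open>real_normed_algebra\<close> does not require a unit.\<close>

class cstar_algebra = complex_vector + real_normed_algebra + banach +
  fixes star :: "'a \<Rightarrow> 'a"
  assumes scaleC_of_real: "complex_of_real r *\<^sub>C a = r *\<^sub>R a"
    and norm_scaleC: "norm (c *\<^sub>C a) = cmod c * norm a"
    and scaleC_mult_left: "(c *\<^sub>C a) * b = c *\<^sub>C (a * b)"
    and scaleC_mult_right: "a * (c *\<^sub>C b) = c *\<^sub>C (a * b)"
    and star_star: "star (star a) = a"
    and star_add: "star (a + b) = star a + star b"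
    and star_scaleC: "star (c *\<^sub>C a) = cnj c *\<^sub>C star a"
    and star_mult: "star (a * b) = star b * star a"
    and cstar_identity: "norm (star a * a) = (norm a)\<^sup>2"

definition cpos :: "'a::cstar_algebra \<Rightarrow> bool"
  where "cpos a \<longleftrightarrow> (\<exists>b. a = star b * b)"

definition cle :: "'a::cstar_algebra \<Rightarrow> 'a \<Rightarrow> bool"  (infix "\<preceq>" 50)
  where "a \<preceq> b \<longleftrightarrow> cpos (b - a)"


section \<open>Hilbert C*-modules\<close>

text \<open>
  The module lives on a carrier set inside a complex vector space, so that sequence modules
  such as \<open>l2\<close> below are described on the same footing as abstract modules.
\<close>

record ('a, 'x) hmod =
  hcarrier :: "'x set"
  hact :: "'x \<Rightarrow> 'a \<Rightarrow> 'x"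
  hinner :: "'x \<Rightarrow> 'x \<Rightarrow> 'a"

definition hnorm :: "('a::cstar_algebra, 'x) hmod \<Rightarrow> 'x \<Rightarrow> real"
  where "hnorm X x = sqrt (norm (hinner X x x))"

definition hlim :: "('a::cstar_algebra, 'x::complex_vector) hmod \<Rightarrow> (nat \<Rightarrow> 'x) \<Rightarrow> 'x \<Rightarrow> bool"
  where "hlim X s l \<longleftrightarrow> (\<lambda>n. hnorm X (s n - l)) \<longlonglongrightarrow> 0"

definition hcauchy :: "('a::cstar_algebra, 'x::complex_vector) hmod \<Rightarrow> (nat \<Rightarrow> 'x) \<Rightarrow> bool"
  where "hcauchy X s \<longleftrightarrow> (\<forall>e>0. \<exists>N. \<forall>m\<ge>N. \<forall>n\<ge>N. hnorm X (s m - s n) < e)"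

locale hilbert_module =
  fixes X :: "('a::cstar_algebra, 'x::complex_vector) hmod"
  assumes zero_closed: "0 \<in> hcarrier X"
    and add_closed: "x \<in> hcarrier X \<Longrightarrow> y \<in> hcarrier X \<Longrightarrow> x + y \<in> hcarrier X"
    and scaleC_closed: "x \<in> hcarrier X \<Longrightarrow> c *\<^sub>C x \<in> hcarrier X"
    and act_closed: "x \<in> hcarrier X \<Longrightarrow> hact X x a \<in> hcarrier X"
    and act_add_left: "x \<in> hcarrier X \<Longrightarrow> y \<in> hcarrier X \<Longrightarrow>
          hact X (x + y) a = hact X x a + hact X y a"
    and act_add_right: "x \<in> hcarrier X \<Longrightarrow> hact X x (a + b) = hact X x a + hact X x b"
    and act_scaleC_left: "x \<in> hcarrier X \<Longrightarrow> hact X (c *\<^sub>C x) a = c *\<^sub>C hact X x a"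
    and act_scaleC_right: "x \<in> hcarrier X \<Longrightarrow> hact X x (c *\<^sub>C a) = c *\<^sub>C hact X x a"
    and act_mult: "x \<in> hcarrier X \<Longrightarrow> hact X x (a * b) = hact X (hact X x a) b"
    and inner_add_right: "x \<in> hcarrier X \<Longrightarrow> y \<in> hcarrier X \<Longrightarrow> z \<in> hcarrier X \<Longrightarrow>
          hinner X x (y + z) = hinner X x y + hinner X x z"
    and inner_scaleC_right: "x \<in> hcarrier X \<Longrightarrow> y \<in> hcarrier X \<Longrightarrow>
          hinner X x (c *\<^sub>C y) = c *\<^sub>C hinner X x y"
    and inner_act_right: "x \<in> hcarrier X \<Longrightarrow> y \<in> hcarrier X \<Longrightarrow>
          hinner X x (hact X y a) = hinner X x y * a"
    and inner_star: "x \<in> hcarrier X \<Longrightarrow> y \<in> hcarrier X \<Longrightarrow>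
          star (hinner X x y) = hinner X y x"
    and inner_pos: "x \<in> hcarrier X \<Longrightarrow> cpos (hinner X x x)"
    and inner_definite: "x \<in> hcarrier X \<Longrightarrow> hinner X x x = 0 \<Longrightarrow> x = 0"
    and complete: "(\<And>n. s n \<in> hcarrier X) \<Longrightarrow> hcauchy X s \<Longrightarrow>
          \<exists>l\<in>hcarrier X. hlim X s l"

definition closed_submodule :: "('a::cstar_algebra, 'x::complex_vector) hmod \<Rightarrow> 'x set \<Rightarrow> bool"
  where "closed_submodule X Y \<longleftrightarrow>
    Y \<subseteq> hcarrier X \<and> 0 \<in> Y \<and>
    (\<forall>x\<in>Y. \<forall>y\<in>Y. x + y \<in> Y) \<and>
    (\<forall>c. \<forall>x\<in>Y. c *\<^sub>C x \<in> Y) \<and>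
    (\<forall>a. \<forall>x\<in>Y. hact X x a \<in> Y) \<and>
    (\<forall>s. \<forall>l\<in>hcarrier X. (\<forall>n. s n \<in> Y) \<longrightarrow> hlim X s l \<longrightarrow> l \<in> Y)"

definition cstar_mod :: "('a::cstar_algebra, 'a) hmod"
  where "cstar_mod = \<lparr>hcarrier = UNIV, hact = (*), hinner = (\<lambda>a b. star a * b)\<rparr>"

definition l2 :: "('a::cstar_algebra, nat \<Rightarrow> 'a) hmod"
  where "l2 = \<lparr>hcarrier = {a. summable (\<lambda>n. star (a n) * a n)},
               hact = (\<lambda>a b n. a n * b),
               hinner = (\<lambda>a b. \<Sum>n. star (a n) * b n)\<rparr>"


section \<open>Adjointable operators\<close>

text \<open>
  Operators are total functions of which only the values on the carrier matter; hence
  equality of operators is stated pointwise on carriers, and \<open>adj\<close> and \<open>op_inv\<close> are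
  determined on carriers only. Linearity and boundedness of adjointable maps are automatic.
\<close>

definition is_adj :: "('a::cstar_algebra, 'x) hmod \<Rightarrow> ('a, 'y) hmod \<Rightarrow>
    ('x \<Rightarrow> 'y) \<Rightarrow> ('y \<Rightarrow> 'x) \<Rightarrow> bool"
  where "is_adj X Y T S \<longleftrightarrow>
    T ` hcarrier X \<subseteq> hcarrier Y \<and> S ` hcarrier Y \<subseteq> hcarrier X \<and>
    (\<forall>x\<in>hcarrier X. \<forall>y\<in>hcarrier Y. hinner Y (T x) y = hinner X x (S y))"

definition adjointable :: "('a::cstar_algebra, 'x) hmod \<Rightarrow> ('a, 'y) hmod \<Rightarrow> ('x \<Rightarrow> 'y) set"
  where "adjointable X Y = {T. \<exists>S. is_adj X Y T S}"

definition adj :: "('a::cstar_algebra, 'x) hmod \<Rightarrow> ('a, 'y) hmod \<Rightarrow> ('x \<Rightarrow> 'y) \<Rightarrow> 'y \<Rightarrow> 'x"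
  where "adj X Y T = (SOME S. is_adj X Y T S)"

lemma is_adj_adj: "T \<in> adjointable X Y \<Longrightarrow> is_adj X Y T (adj X Y T)"
  unfolding adjointable_def adj_def by (auto intro: someI[of "is_adj X Y T"])

definition op_inv :: "('a::cstar_algebra, 'x) hmod \<Rightarrow> ('x \<Rightarrow> 'x) \<Rightarrow> 'x \<Rightarrow> 'x"
  where "op_inv X T = (SOME S. S \<in> adjointable X X \<and>
    (\<forall>x\<in>hcarrier X. S (T x) = x \<and> T (S x) = x))"

definition oblique_projection ::
    "('a::cstar_algebra, 'x::complex_vector) hmod \<Rightarrow> 'x set \<Rightarrow> 'x set \<Rightarrow> ('x \<Rightarrow> 'x) \<Rightarrow> bool"
  where "oblique_projection H Y Z F \<longleftrightarrow>
    closed_submodule H Y \<and> closed_submodule H Z \<and>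
    Y \<inter> Z = {0} \<and> hcarrier H = {y + z | y z. y \<in> Y \<and> z \<in> Z} \<and>
    (\<forall>y\<in>Y. \<forall>z\<in>Z. F (y + z) = y)"


section \<open>The multiplier module\<close>

definition mult_module :: "('a::cstar_algebra, 'x) hmod \<Rightarrow> ('a \<Rightarrow> 'x) set"
  where "mult_module X = adjointable cstar_mod X"

definition mult_embed :: "('a::cstar_algebra, 'x) hmod \<Rightarrow> 'x \<Rightarrow> 'a \<Rightarrow> 'x"
  where "mult_embed X x = (\<lambda>a. hact X x a)"

text \<open>
  The element \<open>\<langle>v, x\<rangle>\<close> of the algebra for a multiplier \<open>v\<close> and \<open>x\<close> in the module: the
  operator \<open>v\<^sup>* w\<close> with \<open>w = mult_embed X x\<close> is left multiplication by \<open>v\<^sup>* x\<close>. The product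
  \<open>v a\<close> of a multiplier with an algebra element is, likewise, the value \<open>v a\<close> of the operator.
\<close>

definition mult_inner :: "('a::cstar_algebra, 'x) hmod \<Rightarrow> ('a \<Rightarrow> 'x) \<Rightarrow> 'x \<Rightarrow> 'a"
  where "mult_inner X v x = adj cstar_mod X v x"

lemma cstar_separating:
  fixes b c :: "'a::cstar_algebra"
  assumes "\<And>a. star a * b = star a * c"
  shows "b = c"
proof -
  have "star (b - c) * (b - c) = 0"
    by (simp add: right_diff_distrib assms)
  then have "norm (b - c) = 0"
    using cstar_identity[of "b - c"] by simp
  then show ?thesis by simp
qed

context hilbert_module
begin

lemma is_adj_mult_embed:
  assumes "x \<in> hcarrier X"
  shows "is_adj cstar_mod X (mult_embed X x) (hinner X x)"
proof -
  have "hinner X (hact X x a) y = star a * hinner X x y" if "y \<in> hcarrier X" for a y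
    by (metis act_closed assms inner_act_right inner_star star_mult that)
  then show ?thesis
    using assms by (auto simp: is_adj_def cstar_mod_def mult_embed_def act_closed)
qed

lemma mult_inner_embed:
  assumes "x \<in> hcarrier X" "y \<in> hcarrier X"
  shows "mult_inner X (mult_embed X x) y = hinner X x y"
proof -
  have "is_adj cstar_mod X (mult_embed X x) (adj cstar_mod X (mult_embed X x))"
    using is_adj_mult_embed[OF assms(1)] by (intro is_adj_adj) (auto simp: adjointable_def)
  with is_adj_mult_embed[OF assms(1)] assms(2)
  have "star a * adj cstar_mod X (mult_embed X x) y = star a * hinner X x y" for a
    by (auto simp: is_adj_def cstar_mod_def)
  then show ?thesis
    unfolding mult_inner_def by (rule cstar_separating)
qed

lemma mult_inner_left_mult:
  assumes "v \<in> mult_module X" "x \<in> hcarrier X"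
  shows "adj cstar_mod X v (mult_embed X x a) = mult_inner X v x * a"
proof -
  have adj: "is_adj cstar_mod X v (adj cstar_mod X v)"
    using assms(1) unfolding mult_module_def by (rule is_adj_adj)
  then have *: "star b * adj cstar_mod X v y = hinner X (v b) y" "v b \<in> hcarrier X"
    if "y \<in> hcarrier X" for b y
    using that by (auto simp: is_adj_def cstar_mod_def)
  have "star b * adj cstar_mod X v (hact X x a) = star b * (adj cstar_mod X v x * a)" for b
    using *[of x b] *[of "hact X x a" b] assms(2)
    by (simp add: act_closed inner_act_right mult.assoc[symmetric])
  then show ?thesis
    unfolding mult_inner_def mult_embed_def by (rule cstar_separating)
qed

end


section \<open>Frames and outer frames\<close>

definition is_frame :: "('a::cstar_algebra, 'x) hmod \<Rightarrow> (nat \<Rightarrow> 'x) \<Rightarrow> bool"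
  where "is_frame X xs \<longleftrightarrow>
    (\<forall>n. xs n \<in> hcarrier X) \<and>
    (\<exists>A>0. \<exists>B>0. \<forall>x\<in>hcarrier X.
       summable (\<lambda>n. hinner X x (xs n) * hinner X (xs n) x) \<and>
       A *\<^sub>R hinner X x x \<preceq> (\<Sum>n. hinner X x (xs n) * hinner X (xs n) x) \<and>
       (\<Sum>n. hinner X x (xs n) * hinner X (xs n) x) \<preceq> B *\<^sub>R hinner X x x)"

text \<open>For a multiplier \<open>v\<close>, the element \<open>\<langle>x, v\<rangle>\<close> is \<open>\<langle>v, x\<rangle>\<^sup>*\<close>.\<close>

definition is_outer_frame :: "('a::cstar_algebra, 'x) hmod \<Rightarrow> (nat \<Rightarrow> 'a \<Rightarrow> 'x) \<Rightarrow> bool"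
  where "is_outer_frame X vs \<longleftrightarrow>
    (\<forall>n. vs n \<in> mult_module X) \<and>
    (\<exists>n. vs n \<in> mult_module X - mult_embed X ` hcarrier X) \<and>
    (\<exists>A>0. \<exists>B>0. \<forall>x\<in>hcarrier X.
       summable (\<lambda>n. star (mult_inner X (vs n) x) * mult_inner X (vs n) x) \<and>
       A *\<^sub>R hinner X x x \<preceq> (\<Sum>n. star (mult_inner X (vs n) x) * mult_inner X (vs n) x) \<and>
       (\<Sum>n. star (mult_inner X (vs n) x) * mult_inner X (vs n) x) \<preceq> B *\<^sub>R hinner X x x)"

text \<open>Sequences of multipliers that are a frame (embedded in the multiplier module) or an
  outer frame.\<close>

definition frame_or_outer :: "('a::cstar_algebra, 'x) hmod \<Rightarrow> (nat \<Rightarrow> 'a \<Rightarrow> 'x) \<Rightarrow> bool"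
  where "frame_or_outer X vs \<longleftrightarrow>
    (\<exists>xs. is_frame X xs \<and> vs = (\<lambda>n. mult_embed X (xs n))) \<or> is_outer_frame X vs"

definition analysis :: "('a::cstar_algebra, 'x) hmod \<Rightarrow> (nat \<Rightarrow> 'a \<Rightarrow> 'x) \<Rightarrow> 'x \<Rightarrow> nat \<Rightarrow> 'a"
  where "analysis X vs = (\<lambda>x n. mult_inner X (vs n) x)"

definition dual_to :: "('a::cstar_algebra, 'x::complex_vector) hmod \<Rightarrow>
    (nat \<Rightarrow> 'a \<Rightarrow> 'x) \<Rightarrow> (nat \<Rightarrow> 'a \<Rightarrow> 'x) \<Rightarrow> bool"
  where "dual_to X ys xs \<longleftrightarrow>
    (\<forall>x\<in>hcarrier X. hlim X (\<lambda>N. \<Sum>n<N. ys n (mult_inner X (xs n) x)) x)"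

end

theory Submission
  imports Defs
begin

text \<open>
  If \<open>V\<close> is the analysis operator of a dual of \<open>(x\<^sub>n)\<close>, then \<open>V\<^sup>* U = 1\<close>, so \<open>F = U V\<^sup>*\<close> is an idempotent with
  range \<open>R(U)\<close>, the kernel of \<open>F\<close> is a closed complement, and \<open>F\<^sup>* U (U\<^sup>* U)\<^sup>-\<^sup>1 = V U\<^sup>* U (U\<^sup>* U)\<^sup>-\<^sup>1 = V\<close>.
  Conversely, for \<open>V = F\<^sup>* U (U\<^sup>* U)\<^sup>-\<^sup>1\<close> the relation \<open>F U = U\<close> gives \<open>V\<^sup>* U = 1\<close>. The coordinates of \<open>V\<close>
  are given by the multipliers \<open>V\<^sup>* e\<^sub>n\<close>; boundedness of \<open>V\<close> yields the upper frame bound, and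
  \<open>\<langle>x, x\<rangle> = \<langle>U\<^sup>* V x, U\<^sup>* V x\<rangle> \<le> \<parallel>U\<parallel>\<^sup>2 \<langle>V x, V x\<rangle>\<close> the lower one. The order arguments rest on the facts that
  the elements \<open>b\<^sup>* b\<close> form a closed convex cone on which the norm is monotone, proved in the
  unitization by square roots given by a power series and Kaplansky's argument.
\<close>

text \<open>Positivity is given algebraically, as \<open>a = star b * b\<close>, and from this form
  not even closure of the cone under sums is visible. The condition
  \<open>norm (of_real t - h) \<le> t\<close> makes sums immediate and turns
  \<open>star b * b\<close> into the hard case; it uses scalars as algebra elements, and this is
  what forces the unitization. The second obstacle is the passage from norm bounds to bounds in the
  order of the algebra: a norm bound on \<open>V x\<close> at a single \<open>x\<close> gives no
  order inequality, so inequalities between inner products are drawn from self-adjoint contractions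
  on the whole module. Third, completeness is available for \<open>X\<close> only, since
  \<open>l2\<close> enters merely as an inner product module. Hence boundedness is proved for
  operators that start at \<open>X\<close> and passed to their adjoints, while closedness of range
  and kernel of \<open>F\<close> has to rest on adjointability alone. Finally, adjointability of
  \<open>U\<close> and invertibility of \<open>U' \<circ> U\<close> are themselves drawn from the
  frame inequalities, the one by convergence of the synthesis series, the other by a fixed point
  argument.\<close>

lemma scaleC_minus_left: "(- c) *\<^sub>C (x::'a::complex_vector) = - (c *\<^sub>C x)"
proof -
  have "0 *\<^sub>C x = 0"
    using scaleC_add_left[of 0 0 x] by simp
  then show ?thesis
    using scaleC_add_left[of c "- c" x] by (simp add: eq_neg_iff_add_eq_0 add.commute)
qed

lemma scaleC_zero_left [simp]: "0 *\<^sub>C (x::'a::complex_vector) = 0"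
  using scaleC_add_left[of 0 0 x] by simp

lemma scaleC_zero_right [simp]: "c *\<^sub>C (0::'a::complex_vector) = 0"
  using scaleC_add_right[of c 0 0] by simp

lemma scaleC_minus_right: "c *\<^sub>C (- x) = - (c *\<^sub>C (x::'a::complex_vector))"
  using scaleC_add_right[of c x "- x"] by (simp add: eq_neg_iff_add_eq_0 add.commute)

lemma scaleC_diff_right: "c *\<^sub>C (x - y) = c *\<^sub>C x - c *\<^sub>C (y::'a::complex_vector)"
  using scaleC_add_right[of c x "- y"] by (simp add: scaleC_minus_right)

lemma scaleC_minus_one: "(- 1) *\<^sub>C x = - (x::'a::complex_vector)"
  by (simp add: scaleC_minus_left scaleC_one)

lemma scaleC_scaleR: "c *\<^sub>C (r *\<^sub>R a) = r *\<^sub>R (c *\<^sub>C (a::'a::cstar_algebra))"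
  by (simp flip: scaleC_of_real add: scaleC_scaleC mult.commute)

lemma star_zero [simp]: "star (0::'a::cstar_algebra) = 0"
  using star_add[of 0 0] by simp

lemma star_minus [simp]: "star (- a) = - star (a::'a::cstar_algebra)"
  using star_add[of a "- a"] by (simp add: eq_neg_iff_add_eq_0 add.commute)

lemma star_diff: "star (a - b) = star a - star (b::'a::cstar_algebra)"
  using star_add[of a "- b"] by simp

lemma star_scaleR: "star (r *\<^sub>R a) = r *\<^sub>R star (a::'a::cstar_algebra)"
  by (metis complex_cnj_complex_of_real scaleC_of_real star_scaleC)

lemma norm_star_le: "norm a \<le> norm (star (a::'a::cstar_algebra))"
proof (cases "a = 0")
  case False
  have "norm a * norm a \<le> norm (star a) * norm a"
    using cstar_identity[of a] norm_mult_ineq[of "star a" a] by (simp add: power2_eq_square)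
  then show ?thesis using False by simp
qed simp

lemma norm_star [simp]: "norm (star a) = norm (a::'a::cstar_algebra)"
  using norm_star_le[of a] norm_star_le[of "star a"] by (simp add: star_star)

lemma bounded_linear_star: "bounded_linear (star :: 'a::cstar_algebra \<Rightarrow> 'a)"
  by (rule bounded_linear_intro[where K = 1]) (simp_all add: star_add star_scaleR)

lemma star_mult_self_eq_0 [simp]: "star a * a = 0 \<longleftrightarrow> a = (0::'a::cstar_algebra)"
  using cstar_identity[of a] by auto

section \<open>The unitization\<close>

datatype 'a unital = Unital (alg: 'a) (scal: complex)

instantiation unital :: (cstar_algebra) complex_vector
begin

definition "0 = Unital 0 0"
definition "u + v = Unital (alg u + alg v) (scal u + scal v)"
definition "- u = Unital (- alg u) (- scal u)"
definition "u - v = Unital (alg u - alg v) (scal u - scal v)"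
definition "c *\<^sub>C u = Unital (c *\<^sub>C alg u) (c * scal u)"

instance
  by standard (simp_all add: zero_unital_def plus_unital_def uminus_unital_def minus_unital_def
      scaleC_unital_def scaleC_add_left scaleC_add_right scaleC_scaleC scaleC_one algebra_simps)

end

lemma alg_simps [simp]:
  "alg 0 = 0" "alg (u + v) = alg u + alg v" "alg (- u) = - alg u" "alg (u - v) = alg u - alg v"
  "alg (c *\<^sub>C u) = c *\<^sub>C alg u"
  by (simp_all add: zero_unital_def plus_unital_def uminus_unital_def minus_unital_def
      scaleC_unital_def)

lemma scal_simps [simp]:
  "scal 0 = 0" "scal (u + v) = scal u + scal v" "scal (- u) = - scal u" "scal (u - v) = scal u - scal v"
  "scal (c *\<^sub>C u) = c * scal u"
  by (simp_all add: zero_unital_def plus_unital_def uminus_unital_def minus_unital_def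
      scaleC_unital_def)

section \<open>Left multiplication operators of the unitization on the original algebra\<close>

definition uop :: "'a::cstar_algebra unital \<Rightarrow> 'a \<Rightarrow> 'a"
  where "uop u x = alg u * x + scal u *\<^sub>C x"

lemma bounded_linear_uop: "bounded_linear (uop u)"
proof (rule bounded_linear_intro[where K = "norm (alg u) + cmod (scal u)"])
  show "norm (uop u x) \<le> norm x * (norm (alg u) + cmod (scal u))" for x
    unfolding uop_def
    by (rule order_trans[OF norm_triangle_ineq])
      (simp add: norm_scaleC distrib_left distrib_right norm_mult_ineq mult.commute[of "norm x"])
qed (simp_all add: uop_def scaleC_add_right scaleC_scaleR algebra_simps)

lemma norm_uop_le: "norm (uop u x) \<le> onorm (uop u) * norm x"
  by (rule onorm[OF bounded_linear_uop])

lemma onorm_uop_nonneg: "0 \<le> onorm (uop u)"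
  by (rule onorm_pos_le[OF bounded_linear_uop])

text \<open>Left multiplication is isometric because it attains the norm at \<open>star a\<close>:
  by the C*-identity, \<open>a * star a\<close> has the norm of \<open>a\<close> squared.\<close>

lemma onorm_uop_alg: "onorm (uop (Unital a 0)) = norm a"
proof (rule antisym)
  show "onorm (uop (Unital a 0)) \<le> norm a"
    by (rule onorm_bound) (simp_all add: uop_def norm_mult_ineq)
  have "(norm a)\<^sup>2 = norm (uop (Unital a 0) (star a))"
    using cstar_identity[of "star a"] by (simp add: uop_def star_star)
  also have "\<dots> \<le> onorm (uop (Unital a 0)) * norm a"
    using norm_uop_le[of "Unital a 0" "star a"] by simp
  finally show "norm a \<le> onorm (uop (Unital a 0))"
    by (cases "a = 0") (simp_all add: power2_eq_square onorm_uop_nonneg)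
qed

lemma uop_add: "uop (u + v) = (\<lambda>x. uop u x + uop v x)"
  by (rule ext) (simp add: uop_def scaleC_add_left algebra_simps)

lemma onorm_uop_add: "onorm (uop (u + v)) \<le> onorm (uop u) + onorm (uop v)"
  unfolding uop_add by (rule onorm_triangle[OF bounded_linear_uop bounded_linear_uop])

lemma onorm_uop_scaleC: "onorm (uop (c *\<^sub>C u)) = cmod c * onorm (uop u)"
proof -
  have *: "onorm (uop (c *\<^sub>C u)) \<le> cmod c * onorm (uop u)" for c and u :: "'a unital"
  proof (rule onorm_bound)
    have "uop (c *\<^sub>C u) x = c *\<^sub>C uop u x" for x
      by (simp add: uop_def scaleC_add_right scaleC_mult_left scaleC_scaleC)
    then show "norm (uop (c *\<^sub>C u) x) \<le> cmod c * onorm (uop u) * norm x" for x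
      by (simp add: norm_scaleC mult.assoc mult_left_mono norm_uop_le)
  qed (simp add: onorm_uop_nonneg)
  show ?thesis
  proof (cases "c = 0")
    case True
    then show ?thesis using *[of c u] onorm_uop_nonneg[of "c *\<^sub>C u"] by simp
  next
    case False
    have "inverse c *\<^sub>C c *\<^sub>C u = u"
      using False by (simp add: scaleC_scaleC scaleC_one)
    then show ?thesis
      using *[of c u] *[of "inverse c" "c *\<^sub>C u"] False
      by (simp add: norm_inverse) (simp add: field_simps)
  qed
qed

instantiation unital :: (cstar_algebra) real_vector
begin

definition "r *\<^sub>R u = complex_of_real r *\<^sub>C (u :: 'a unital)"

instance
  by standard (simp_all add: scaleR_unital_def scaleC_add_left scaleC_add_right scaleC_scaleC
      scaleC_one)

end

instantiation unital :: (cstar_algebra) real_normed_vector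
begin

text \<open>The operator norm on \<open>'a\<close> alone is degenerate when \<open>'a\<close> already has a unit, hence
  the maximum with the character \<^const>\<open>scal\<close>.\<close>
definition "norm u = max (cmod (scal u)) (onorm (uop u))"
definition "dist u v = norm (u - v :: 'a unital)"
definition "sgn u = inverse (norm u) *\<^sub>R (u :: 'a unital)"
definition "uniformity = (INF e\<in>{0<..}. principal {(u, v :: 'a unital). dist u v < e})"
definition "open S = (\<forall>u\<in>S. \<forall>\<^sub>F (v, w) in uniformity. v = u \<longrightarrow> w \<in> (S :: 'a unital set))"

text \<open>The algebra part is \<open>u\<close> minus a scalar multiple of the unit. Together with
  \<open>norm_unital_le\<close> this makes the norm equivalent to the sum of the norms of the two
  components, which gives definiteness and completeness.\<close>

lemma norm_alg_le: "norm (alg u) \<le> norm u + cmod (scal u)"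
proof -
  define s where "s = (- scal u) *\<^sub>C Unital (0 :: 'a) 1"
  have "Unital (alg u) 0 = u + s"
    by (simp add: s_def plus_unital_def scaleC_unital_def)
  then have "norm (alg u) \<le> onorm (uop u) + onorm (uop s)"
    by (metis onorm_uop_alg onorm_uop_add)
  also have "onorm (uop s) \<le> cmod (scal u)"
    by (rule onorm_bound) (simp_all add: s_def uop_def scaleC_unital_def norm_scaleC)
  finally show ?thesis
    by (simp add: norm_unital_def)
qed

lemma norm_unital_le: "norm u \<le> norm (alg u) + cmod (scal u)"
proof -
  have "onorm (uop u) \<le> norm (alg u) + cmod (scal u)"
  proof (rule onorm_bound)
    show "norm (uop u x) \<le> (norm (alg u) + cmod (scal u)) * norm x" for x
      unfolding uop_def
      by (rule order_trans[OF norm_triangle_ineq])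
        (simp add: norm_scaleC distrib_left distrib_right norm_mult_ineq mult.commute[of "norm x"])
  qed simp
  then show ?thesis
    by (simp add: norm_unital_def)
qed

lemma norm_scaleC_unital: "norm (c *\<^sub>C u) = cmod c * norm (u :: 'a unital)"
  by (simp add: norm_unital_def onorm_uop_scaleC max_mult_distrib_left norm_mult)

instance
proof
  fix u v :: "'a unital" and r :: real
  show "dist u v = norm (u - v)" "sgn u = u /\<^sub>R norm u"
    "uniformity = (INF e\<in>{0<..}. principal {(u, v :: 'a unital). dist u v < e})"
    "open S = (\<forall>u\<in>S. \<forall>\<^sub>F (v, w) in uniformity. v = u \<longrightarrow> w \<in> (S :: 'a unital set))"
    for S :: "'a unital set"
    by (rule dist_unital_def sgn_unital_def uniformity_unital_def open_unital_def)+
  show "norm u = 0 \<longleftrightarrow> u = 0"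
  proof
    assume "norm u = 0"
    then have "cmod (scal u) \<le> 0"
      unfolding norm_unital_def by (metis max.cobounded1)
    then have "scal u = 0"
      by simp
    then have "alg u = 0"
      using norm_alg_le[of u] \<open>norm u = 0\<close> by simp
    with \<open>scal u = 0\<close> show "u = 0"
      by (cases u) (simp add: zero_unital_def)
  next
    assume "u = 0"
    then show "norm u = 0"
      using norm_unital_le[of u] onorm_uop_nonneg[of u] by (simp add: norm_unital_def)
  qed
  have "cmod (scal (u + v)) \<le> cmod (scal u) + cmod (scal v)"
    by (simp add: norm_triangle_ineq)
  then show "norm (u + v) \<le> norm u + norm v"
    using onorm_uop_add[of u v] unfolding norm_unital_def by linarith
  show "norm (r *\<^sub>R u) = \<bar>r\<bar> * norm u"
    by (simp add: scaleR_unital_def norm_scaleC_unital)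
qed

end

instance unital :: (cstar_algebra) banach
proof
  fix us :: "nat \<Rightarrow> 'a unital"
  assume us: "Cauchy us"
  have scal: "cmod (scal u) \<le> norm u" for u :: "'a unital"
    by (simp add: norm_unital_def)
  have dist: "dist (scal (us m)) (scal (us n)) \<le> dist (us m) (us n)"
    "dist (alg (us m)) (alg (us n)) \<le> 2 * dist (us m) (us n)" for m n
    using scal[of "us m - us n"] norm_alg_le[of "us m - us n"] by (simp_all add: dist_norm)
  have "Cauchy (\<lambda>n. scal (us n))"
    using us dist(1) unfolding Cauchy_def by (meson order_le_less_trans)
  moreover have "Cauchy (\<lambda>n. alg (us n))"
    unfolding Cauchy_def
  proof (intro allI impI)
    fix e :: real assume "e > 0"
    then obtain M where "\<forall>m\<ge>M. \<forall>n\<ge>M. dist (us m) (us n) < e / 2"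
      using us unfolding Cauchy_def by (meson half_gt_zero)
    then show "\<exists>M. \<forall>m\<ge>M. \<forall>n\<ge>M. dist (alg (us m)) (alg (us n)) < e"
      using dist(2) by (smt (verit) field_sum_of_halves)
  qed
  ultimately obtain l a where l: "(\<lambda>n. scal (us n)) \<longlonglongrightarrow> l" and a: "(\<lambda>n. alg (us n)) \<longlonglongrightarrow> a"
    by (metis Cauchy_convergent_iff convergent_def)
  have "(\<lambda>n. norm (alg (us n) - a) + cmod (scal (us n) - l)) \<longlonglongrightarrow> 0 + 0"
    by (intro tendsto_add) (use a l in \<open>simp_all add: tendsto_norm_zero LIM_zero\<close>)
  moreover have "norm (us n - Unital a l) \<le> norm (alg (us n) - a) + cmod (scal (us n) - l)" for n
    using norm_unital_le[of "us n - Unital a l"] by simp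
  ultimately have "(\<lambda>n. us n - Unital a l) \<longlonglongrightarrow> 0"
    by (rule_tac Lim_null_comparison[OF always_eventually]) simp_all
  then have "us \<longlonglongrightarrow> Unital a l"
    by (rule LIM_zero_cancel)
  then show "convergent us"
    by (rule convergentI)
qed

instantiation unital :: (cstar_algebra) real_normed_algebra_1
begin

definition "1 = Unital 0 1"
definition "u * v = Unital (alg u * alg v + scal u *\<^sub>C alg v + scal v *\<^sub>C alg u) (scal u * scal v)"

lemma uop_mult: "uop (u * v) x = uop u (uop v x)"
  by (simp add: uop_def times_unital_def scaleC_add_right scaleC_mult_left scaleC_mult_right
      scaleC_scaleC distrib_left distrib_right mult.assoc add_ac)

lemma onorm_uop_mult: "onorm (uop (u * v)) \<le> onorm (uop u) * onorm (uop v)"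
  using onorm_compose[OF bounded_linear_uop bounded_linear_uop, of u v]
  by (simp add: comp_def uop_mult[abs_def])

instance
proof
  fix u v w :: "'a unital" and r :: real
  show "u * v * w = u * (v * w)" "(u + v) * w = u * w + v * w" "u * (v + w) = u * v + u * w"
    "1 * u = u" "u * 1 = u"
    by (cases u; cases v; cases w;
        simp add: one_unital_def times_unital_def plus_unital_def scaleC_add_left scaleC_add_right scaleC_scaleC
        scaleC_one scaleC_mult_left scaleC_mult_right algebra_simps)+
  show "r *\<^sub>R u * v = r *\<^sub>R (u * v)" "u * r *\<^sub>R v = r *\<^sub>R (u * v)"
    by (simp_all add: times_unital_def scaleR_unital_def scaleC_unital_def scaleC_add_right
        scaleC_scaleC scaleC_mult_left scaleC_mult_right algebra_simps)
  show "(0 :: 'a unital) \<noteq> 1"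
    by (simp add: zero_unital_def one_unital_def)
  have "onorm (uop (u * v)) \<le> onorm (uop u) * onorm (uop v)"
    by (rule onorm_uop_mult)
  also have "\<dots> \<le> norm u * norm v"
    by (intro mult_mono) (auto simp: norm_unital_def onorm_uop_nonneg le_max_iff_disj)
  finally have "onorm (uop (u * v)) \<le> norm u * norm v" .
  moreover have "cmod (scal (u * v)) \<le> norm u * norm v"
    by (simp add: times_unital_def norm_mult)
      (intro mult_mono; auto simp: norm_unital_def le_max_iff_disj)
  ultimately show "norm (u * v) \<le> norm u * norm v"
    by (simp add: norm_unital_def[of "u * v"])
  have "onorm (uop (1 :: 'a unital)) \<le> 1"
    by (rule onorm_bound) (simp_all add: uop_def one_unital_def scaleC_one)
  then show "norm (1 :: 'a unital) = 1"
    by (simp add: norm_unital_def) (simp add: one_unital_def)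
qed

end

lemma scal_mult [simp]: "scal (u * v) = scal u * scal v"
  by (simp add: times_unital_def)

section \<open>The involution and the C*-identity on the unitization\<close>

instantiation unital :: (cstar_algebra) cstar_algebra
begin

definition "star u = Unital (star (alg u)) (cnj (scal u))"

lemma star_star_unital: "star (star u) = (u :: 'a unital)"
  by (simp add: star_unital_def star_star)

text \<open>With the form \<open>star x * y\<close> the algebra is a module over itself, on which
  \<open>star u\<close> acts as the adjoint of \<open>u\<close>.\<close>

lemma uop_star: "star x * uop u y = star (uop (star u) x) * y"
  by (simp add: uop_def star_unital_def star_add star_mult star_star star_scaleC
      scaleC_mult_left scaleC_mult_right distrib_left distrib_right mult.assoc)

text \<open>The argument for operators on a Hilbert space, with \<open>star x * y\<close> as inner
  product: the square of \<open>norm (uop u x)\<close> is the norm of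
  \<open>star x * uop (star u * u) x\<close>.\<close>

lemma onorm_uop_square_le: "(onorm (uop u))\<^sup>2 \<le> onorm (uop (star u * u))"
proof -
  define k where "k = onorm (uop (star u * u))"
  have "k \<ge> 0"
    by (simp add: k_def onorm_uop_nonneg)
  have "norm (uop u x) \<le> sqrt k * norm x" for x
  proof -
    have "(norm (uop u x))\<^sup>2 = norm (star x * uop (star u * u) x)"
      by (simp add: uop_mult uop_star[of x "star u"] star_star_unital cstar_identity)
    also have "\<dots> \<le> norm x * (k * norm x)"
      by (rule order_trans[OF norm_mult_ineq]) (simp add: mult_left_mono norm_uop_le k_def)
    also have "\<dots> = (sqrt k * norm x)\<^sup>2"
      using \<open>k \<ge> 0\<close> by (simp add: power2_eq_square mult.left_commute)
    finally show ?thesis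
      by (rule power2_le_imp_le) (simp add: \<open>k \<ge> 0\<close>)
  qed
  then have "onorm (uop u) \<le> sqrt k"
    by (intro onorm_bound) (simp_all add: \<open>k \<ge> 0\<close>)
  then show ?thesis
    unfolding k_def[symmetric] using \<open>k \<ge> 0\<close> onorm_uop_nonneg real_le_rsqrt sqrt_le_D
    by (metis sqrt_ge_absD abs_of_nonneg)
qed

lemma onorm_uop_star_le: "onorm (uop u) \<le> onorm (uop (star u))"
proof (cases "onorm (uop u) = 0")
  case False
  have "(onorm (uop u))\<^sup>2 \<le> onorm (uop (star u)) * onorm (uop u)"
    using onorm_uop_square_le onorm_uop_mult order_trans by blast
  then show ?thesis
    using False onorm_uop_nonneg[of u] by (simp add: power2_eq_square)
qed (simp add: onorm_uop_nonneg)

lemma onorm_uop_cstar: "onorm (uop (star u * u)) = (onorm (uop u))\<^sup>2"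
proof (rule antisym[OF _ onorm_uop_square_le])
  have "onorm (uop (star u)) * onorm (uop u) \<le> onorm (uop u) * onorm (uop u)"
    using onorm_uop_star_le[of "star u"]
    by (intro mult_right_mono) (simp_all add: star_star_unital onorm_uop_nonneg)
  then show "onorm (uop (star u * u)) \<le> (onorm (uop u))\<^sup>2"
    using onorm_uop_mult[of "star u" u] by (simp add: power2_eq_square)
qed

instance
proof
  fix u v w :: "'a unital" and c :: complex and r :: real
  show "complex_of_real r *\<^sub>C u = r *\<^sub>R u"
    by (simp add: scaleR_unital_def)
  show "norm (c *\<^sub>C u) = cmod c * norm u"
    by (rule norm_scaleC_unital)
  show "c *\<^sub>C u * v = c *\<^sub>C (u * v)" "u * c *\<^sub>C v = c *\<^sub>C (u * v)"
    by (simp_all add: times_unital_def scaleC_unital_def scaleC_add_right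
        scaleC_scaleC scaleC_mult_left scaleC_mult_right algebra_simps)
  show "star (star u) = u"
    by (rule star_star_unital)
  show "star (u + v) = star u + star v" "star (c *\<^sub>C u) = cnj c *\<^sub>C star u"
    "star (u * v) = star v * star u"
    by (simp_all add: star_unital_def times_unital_def plus_unital_def scaleC_unital_def
        star_add star_mult star_scaleC)
  have "cmod (scal (star u * u)) = (cmod (scal u))\<^sup>2"
    by (simp add: star_unital_def norm_mult power2_eq_square)
  then show "norm (star u * u) = (norm u)\<^sup>2"
    unfolding norm_unital_def onorm_uop_cstar
    using onorm_uop_nonneg[of u] by (simp add: max_def abs_le_square_iff[symmetric])
qed

end

section \<open>Positive elements of unital C*-algebras\<close>

text \<open>The power series \<open>1 - sqrt (1 - u) = (\<Sum>n. sqrt_coeff n * u ^ n)\<close>; the recursion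
  expresses that its sum \<open>s\<close> satisfies \<open>2 * s = u + s\<^sup>2\<close>.\<close>

function sqrt_coeff :: "nat \<Rightarrow> real" where
  "sqrt_coeff n = (if n = 0 then 0 else if n = 1 then 1 / 2
     else (\<Sum>i\<in>{1..<n}. sqrt_coeff i * sqrt_coeff (n - i)) / 2)"
  by pat_completeness auto
termination by (relation "Wellfounded.measure id") auto

declare sqrt_coeff.simps [simp del]

lemma sqrt_coeff_0 [simp]: "sqrt_coeff 0 = 0"
  by (simp add: sqrt_coeff.simps)

lemma sqrt_coeff_1 [simp]: "sqrt_coeff (Suc 0) = 1 / 2"
  by (simp add: sqrt_coeff.simps)

lemma sqrt_coeff_nonneg: "0 \<le> sqrt_coeff n"
proof (induction n rule: less_induct)
  case (less n)
  then show ?case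
    by (subst sqrt_coeff.simps) (auto intro!: divide_nonneg_nonneg sum_nonneg mult_nonneg_nonneg)
qed

text \<open>The terms \<open>i = 0\<close> and \<open>i = n\<close> vanish because
  \<open>sqrt_coeff 0 = 0\<close>, so the recursion becomes the coefficient form of
  \<open>s\<^sup>2 = 2 * s - u\<close>; the correction at \<open>n = 1\<close> is the coefficient of
  \<open>u\<close>.\<close>

lemma sqrt_coeff_convolution:
  "(\<Sum>i\<le>n. sqrt_coeff i * sqrt_coeff (n - i)) = 2 * sqrt_coeff n - (if n = 1 then 1 else 0)"
proof (cases "n \<le> 1")
  case True
  then consider "n = 0" | "n = 1" by linarith
  then show ?thesis by cases (simp_all add: atMost_Suc)
next
  case False
  then have "{..n} = insert 0 (insert n {1..<n})" by auto
  with False show ?thesis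
    by (simp add: sqrt_coeff.simps[of n])
qed

text \<open>A partial sum \<open>s\<close> controls the next one \<open>s'\<close> through
  \<open>2 * s' - 1 \<le> s * s\<close>: the convolution sums over a triangle, which lies in a
  square. Hence the bound \<open>1\<close> reproduces itself.\<close>

lemma sqrt_coeff_sum_le_1: "(\<Sum>i<n. sqrt_coeff i) \<le> 1"
proof (induction n)
  case (Suc n)
  let ?c = sqrt_coeff
  have "(\<Sum>k<Suc n. 2 * ?c k - (if k = 1 then 1 else 0))
      = (\<Sum>k<Suc n. \<Sum>i\<le>k. ?c i * ?c (k - i))"
    by (simp only: sqrt_coeff_convolution)
  also have "\<dots> = (\<Sum>(i, j)\<in>{(i, j). i + j < Suc n}. ?c i * ?c j)"
    by (rule sum.triangle_reindex[symmetric])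
  \<comment> \<open>A pair outside the smaller square has \<open>i = n\<close> or
    \<open>j = n\<close>, hence its other index is \<open>0\<close>, and
    \<open>sqrt_coeff 0 = 0\<close>. This lets the induction hypothesis at \<open>n\<close> bound
    the sum up to \<open>Suc n\<close>.\<close>
  also have "\<dots> = (\<Sum>(i, j)\<in>{(i, j). i + j < Suc n} \<inter> {..<n} \<times> {..<n}. ?c i * ?c j)"
  proof (rule sum.mono_neutral_right)
    show "finite {(i, j). i + j < Suc n}"
      by (rule finite_subset[of _ "{..n} \<times> {..n}"]) auto
    show "\<forall>x\<in>{(i, j). i + j < Suc n} - {(i, j). i + j < Suc n} \<inter> {..<n} \<times> {..<n}.
        (case x of (i, j) \<Rightarrow> ?c i * ?c j) = 0"
    proof -
      have "?c i * ?c j = 0" if "i + j < Suc n" "\<not> (i < n \<and> j < n)" for i j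
      proof -
        have "i = 0 \<or> j = 0" using that by linarith
        then show ?thesis by auto
      qed
      then show ?thesis by fastforce
    qed
  qed auto
  also have "\<dots> \<le> (\<Sum>(i, j)\<in>{..<n} \<times> {..<n}. ?c i * ?c j)"
    by (rule sum_mono2) (auto simp: sqrt_coeff_nonneg)
  also have "\<dots> = (\<Sum>i<n. ?c i) * (\<Sum>j<n. ?c j)"
    by (simp add: sum_product sum.cartesian_product)
  also have "\<dots> \<le> 1"
    using Suc by (simp add: mult_le_one sum_nonneg sqrt_coeff_nonneg)
  finally have "2 * (\<Sum>k<Suc n. ?c k) - (\<Sum>k<Suc n. if k = 1 then 1 else 0) \<le> 1"
    by (simp add: sum_subtractf sum_distrib_left)
  moreover have "(\<Sum>k<Suc n. if k = 1 then 1 else 0 :: real) \<le> 1"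
    by (simp add: sum.delta)
  ultimately show ?case by linarith
qed simp

lemma summable_sqrt_coeff: "summable sqrt_coeff"
  by (rule summableI_nonneg_bounded[where x = 1]) (simp_all add: sqrt_coeff_nonneg sqrt_coeff_sum_le_1)

definition sqrt_defect :: "'a::{real_normed_algebra_1, banach} \<Rightarrow> 'a"
  where "sqrt_defect u = (\<Sum>n. sqrt_coeff n *\<^sub>R u ^ n)"

context
  fixes u :: "'a::{real_normed_algebra_1, banach}"
  assumes u: "norm u \<le> 1"
begin

lemma norm_sqrt_defect_term: "norm (sqrt_coeff n *\<^sub>R u ^ n) \<le> sqrt_coeff n"
proof -
  have "norm (u ^ n) \<le> 1"
    using norm_power_ineq[of u n] power_le_one[of "norm u" n] u by simp
  then show ?thesis
    using sqrt_coeff_nonneg[of n] by (simp add: mult_left_le)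
qed

lemma summable_norm_sqrt_defect: "summable (\<lambda>n. norm (sqrt_coeff n *\<^sub>R u ^ n))"
  by (rule summable_comparison_test[OF _ summable_sqrt_coeff]) (use norm_sqrt_defect_term in auto)

lemma summable_sqrt_defect: "summable (\<lambda>n. sqrt_coeff n *\<^sub>R u ^ n)"
  by (rule summable_norm_cancel[OF summable_norm_sqrt_defect])

lemma norm_sqrt_defect: "norm (sqrt_defect u) \<le> 1"
proof -
  have "norm (sqrt_defect u) \<le> (\<Sum>n. sqrt_coeff n)"
    unfolding sqrt_defect_def
    by (rule order_trans[OF summable_norm[OF summable_norm_sqrt_defect]])
      (intro suminf_le norm_sqrt_defect_term summable_norm_sqrt_defect summable_sqrt_coeff)
  also have "\<dots> \<le> 1"
    by (rule suminf_le_const[OF summable_sqrt_coeff]) (simp add: sqrt_coeff_sum_le_1)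
  finally show ?thesis .
qed

lemma sqrt_defect_square: "sqrt_defect u * sqrt_defect u = 2 * sqrt_defect u - u"
proof -
  have "(\<lambda>k. \<Sum>i\<le>k. (sqrt_coeff i *\<^sub>R u ^ i) * (sqrt_coeff (k - i) *\<^sub>R u ^ (k - i)))
      sums (sqrt_defect u * sqrt_defect u)"
    unfolding sqrt_defect_def
    by (rule Cauchy_product_sums[OF summable_norm_sqrt_defect summable_norm_sqrt_defect])
  also have "(\<lambda>k. \<Sum>i\<le>k. (sqrt_coeff i *\<^sub>R u ^ i) * (sqrt_coeff (k - i) *\<^sub>R u ^ (k - i)))
      = (\<lambda>k. (2 * sqrt_coeff k - (if k = 1 then 1 else 0)) *\<^sub>R u ^ k)"
    unfolding sqrt_coeff_convolution[symmetric]
    by (simp add: scaleR_left.sum power_add[symmetric] mult.commute)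
  also have "\<dots> = (\<lambda>k. 2 * (sqrt_coeff k *\<^sub>R u ^ k) - (if k = 1 then u ^ k else 0))"
    by (auto simp: scaleR_diff_left scaleR_2[symmetric] mult_2 algebra_simps)
  finally have 1: "(\<lambda>k. 2 * (sqrt_coeff k *\<^sub>R u ^ k) - (if k = 1 then u ^ k else 0))
    sums (sqrt_defect u * sqrt_defect u)" .
  have "(\<lambda>k. 2 * (sqrt_coeff k *\<^sub>R u ^ k) - (if k = 1 then u ^ k else 0))
    sums (2 * sqrt_defect u - u ^ 1)"
    unfolding sqrt_defect_def
    by (intro sums_diff sums_mult summable_sums[OF summable_sqrt_defect] sums_single)
  with 1 show ?thesis by (simp add: sums_unique2)
qed

text \<open>Two elements appear, rather than one commuting with \<open>c\<close>, because
  Kaplansky's argument moves \<open>c\<close> past the roots of two different elements.\<close>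

lemma intertwine_sqrt_defect:
  assumes "norm v \<le> 1" "u * c = c * v"
  shows "sqrt_defect u * c = c * sqrt_defect v"
proof -
  have "u ^ n * c = c * v ^ n" for n
    by (induction n) (simp_all add: mult.assoc assms(2), simp add: assms(2) flip: mult.assoc)
  moreover have "(\<lambda>n. (sqrt_coeff n *\<^sub>R u ^ n) * c) sums (sqrt_defect u * c)"
    unfolding sqrt_defect_def by (intro sums_mult2 summable_sums summable_sqrt_defect)
  moreover have "(\<lambda>n. c * (sqrt_coeff n *\<^sub>R v ^ n)) sums (c * sqrt_defect v)"
    unfolding sqrt_defect_def
    by (intro sums_mult summable_sums summable_norm_cancel[OF summable_comparison_test[OF _ summable_sqrt_coeff]])
      (use norm_power_ineq[of v] power_le_one[of "norm v"] assms(1) sqrt_coeff_nonneg in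
        \<open>auto intro!: exI[of _ 0] mult_left_le intro: order_trans\<close>)
  ultimately show ?thesis by (simp add: sums_unique2)
qed

end

section \<open>Positivity expressed by the norm, and square roots\<close>

lemma star_one [simp]: "star 1 = (1::'a::{cstar_algebra, real_normed_algebra_1})"
  by (metis mult_1 mult_1_right star_mult star_star)

lemma star_of_real [simp]: "star (of_real r) = (of_real r::'a::{cstar_algebra, real_normed_algebra_1})"
  by (simp add: of_real_def star_scaleR)

lemma star_power: "star (u ^ n) = star (u::'a::{cstar_algebra, real_normed_algebra_1}) ^ n"
  by (induction n) (simp_all add: star_mult power_commutes)

lemma star_sqrt_defect:
  assumes "norm u \<le> 1"
  shows "star (sqrt_defect u) = sqrt_defect (star (u::'a::{cstar_algebra, real_normed_algebra_1}))"
  unfolding sqrt_defect_def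
  by (simp add: bounded_linear.suminf[OF bounded_linear_star summable_sqrt_defect[OF assms]]
      star_scaleR star_power)

text \<open>For self-adjoint \<open>h\<close>, \<open>norm (t - h) \<le> t\<close> says that the spectrum lies in \<open>[0, 2 t]\<close>.\<close>

definition upos :: "'a::{cstar_algebra, real_normed_algebra_1} \<Rightarrow> bool"
  where "upos h \<longleftrightarrow> star h = h \<and> (\<exists>t. norm (of_real t - h) \<le> t)"

lemma upos_star: "upos h \<Longrightarrow> star h = h"
  by (simp add: upos_def)

lemma upos_add: "upos h \<Longrightarrow> upos k \<Longrightarrow> upos (h + k)"
proof -
  assume "upos h" "upos k"
  then obtain s t where "norm (of_real s - h) \<le> s" "norm (of_real t - k) \<le> t" "star h = h" "star k = k"
    by (auto simp: upos_def)
  moreover have "of_real (s + t) - (h + k) = (of_real s - h) + (of_real t - k)"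
    by simp
  then have "norm (of_real (s + t) - (h + k)) \<le> norm (of_real s - h) + norm (of_real t - k)"
    by (metis norm_triangle_ineq)
  ultimately show "upos (h + k)"
    unfolding upos_def star_add by (intro conjI exI[of _ "s + t"]) simp_all
qed

lemma upos_scaleR: "0 \<le> r \<Longrightarrow> upos h \<Longrightarrow> upos (r *\<^sub>R h)"
proof -
  assume r: "0 \<le> r" and "upos h"
  then obtain t where t: "norm (of_real t - h) \<le> t" "star h = h"
    by (auto simp: upos_def)
  have "of_real (r * t) - r *\<^sub>R h = r *\<^sub>R (of_real t - h)"
    by (simp add: scaleR_diff_right of_real_def)
  then have "norm (of_real (r * t) - r *\<^sub>R h) = r * norm (of_real t - h)"
    using r by simp
  with t r show "upos (r *\<^sub>R h)"
    by (auto simp: upos_def star_scaleR mult_left_mono intro!: exI[of _ "r * t"])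
qed

lemma upos_of_real: "0 \<le> r \<Longrightarrow> upos (of_real r)"
  by (auto simp: upos_def intro!: exI[of _ r])

lemma upos_norm_diff: "star h = h \<Longrightarrow> norm h \<le> t \<Longrightarrow> upos (of_real t - h)"
  by (auto simp: upos_def star_diff intro!: exI[of _ t])

text \<open>The square root of \<open>h\<close>, as \<open>h\<close> is \<open>t\<close> times
  \<open>1 - u\<close> with \<open>u = 1 - h /\<^sub>R t\<close>. The scale \<open>t\<close> is
  explicit so that two elements can be treated with the same one.\<close>

definition usqrt :: "real \<Rightarrow> 'a::{cstar_algebra, real_normed_algebra_1} \<Rightarrow> 'a"
  where "usqrt t h = sqrt t *\<^sub>R (1 - sqrt_defect (1 - h /\<^sub>R t))"

context
  fixes t :: real
  assumes t: "0 < t"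
begin

lemma norm_one_minus_div:
  fixes h :: "'a::{cstar_algebra, real_normed_algebra_1}"
  assumes "norm (of_real t - h) \<le> t"
  shows "norm (1 - h /\<^sub>R t) \<le> 1"
proof -
  have "1 - h /\<^sub>R t = (of_real t - h) /\<^sub>R t"
    using t by (simp add: scaleR_diff_right of_real_def)
  then have "norm (1 - h /\<^sub>R t) = norm (of_real t - h) / t"
    using t by (simp add: divide_inverse)
  then show ?thesis using t assms by simp
qed

text \<open>The bound \<open>norm ?s \<le> 1\<close> on the defect is the reason for positivity of
  the root: it is the defining condition of \<open>upos\<close> for \<open>1 - ?s\<close> with
  \<open>t = 1\<close>.\<close>

lemma usqrt:
  fixes h :: "'a::{cstar_algebra, real_normed_algebra_1}"
  assumes "norm (of_real t - h) \<le> t" "star h = h"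
  shows upos_usqrt: "upos (usqrt t h)" and usqrt_square: "usqrt t h * usqrt t h = h"
proof -
  let ?s = "sqrt_defect (1 - h /\<^sub>R t)"
  have "star ?s = ?s"
    using assms by (simp add: star_sqrt_defect norm_one_minus_div star_diff star_scaleR)
  moreover have "norm ?s \<le> 1"
    using assms by (intro norm_sqrt_defect norm_one_minus_div)
  ultimately have "upos (1 - ?s)"
    using upos_norm_diff[of ?s 1] by simp
  then show "upos (usqrt t h)"
    unfolding usqrt_def using t by (intro upos_scaleR) simp_all
  have "(1 - ?s) * (1 - ?s) = h /\<^sub>R t"
    using sqrt_defect_square[OF norm_one_minus_div[OF assms(1)]] by (simp add: algebra_simps mult_2)
  then show "usqrt t h * usqrt t h = h"
    using t by (simp add: usqrt_def mult.assoc[symmetric])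
qed

lemma intertwine_usqrt:
  fixes h k :: "'a::{cstar_algebra, real_normed_algebra_1}"
  assumes "norm (of_real t - h) \<le> t" "norm (of_real t - k) \<le> t" "h * c = c * k"
  shows "usqrt t h * c = c * usqrt t k"
  using intertwine_sqrt_defect[OF norm_one_minus_div[OF assms(1)] norm_one_minus_div[OF assms(2)], of c]
    assms(3)
  by (simp add: usqrt_def algebra_simps)

end

text \<open>Allows \<open>t\<close> in the definition of \<open>upos\<close> to be enlarged, so that
  it can be made positive or common to two elements.\<close>

lemma norm_of_real_diff_mono:
  fixes h :: "'a::real_normed_algebra_1"
  assumes "norm (of_real s - h) \<le> s" "s \<le> t"
  shows "norm (of_real t - h) \<le> t"
proof -
  have "norm (of_real t - h) \<le> norm (of_real s - h) + norm (of_real (t - s) :: 'a)"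
    using norm_triangle_ineq[of "of_real s - h" "of_real (t - s)"] by simp
  then show ?thesis using assms unfolding norm_of_real by linarith
qed

lemma uposE:
  assumes "upos h"
  obtains t where "0 < t" "norm (of_real t - h) \<le> t" "star h = h"
proof -
  obtain s where s: "norm (of_real s - h) \<le> s" "star h = h"
    using assms by (auto simp: upos_def)
  have "0 \<le> s"
    using s(1) norm_ge_zero order_trans by blast
  then show thesis
    using norm_of_real_diff_mono[OF s(1), of "s + 1"] s(2) by (intro that[of "s + 1"]) auto
qed

lemma upos_sqrtE:
  assumes "upos h"
  obtains r where "upos r" "star r = r" "r * r = h" "\<And>c. h * c = c * h \<Longrightarrow> r * c = c * r"
proof -
  obtain t where t: "0 < t" "norm (of_real t - h) \<le> t" "star h = h"
    using assms by (rule uposE)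
  show thesis
  proof (rule that)
    show "upos (usqrt t h)"
      by (rule upos_usqrt[OF t])
    then show "star (usqrt t h) = usqrt t h"
      by (rule upos_star)
    show "usqrt t h * usqrt t h = h"
      by (rule usqrt_square[OF t])
    show "usqrt t h * c = c * usqrt t h" if "h * c = c * h" for c
      by (rule intertwine_usqrt[OF t(1,2,2) that])
  qed
qed

text \<open>The element \<open>h + \<i> * r\<close> is unitary.\<close>

lemma norm_le_1_of_sum_squares:
  fixes h r :: "'a::{cstar_algebra, real_normed_algebra_1}"
  assumes "star h = h" "star r = r" "h * r = r * h" "h * h + r * r = 1"
  shows "norm h \<le> 1"
proof -
  define w where "w = h + \<i> *\<^sub>C r"
  have star: "star w = h - \<i> *\<^sub>C r"
    by (simp add: w_def star_add star_scaleC assms scaleC_minus_left)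
  have "star w * w = h * h + r * r"
    unfolding star
    by (simp add: w_def distrib_left left_diff_distrib scaleC_mult_left scaleC_mult_right
        assms(3) scaleC_diff_right scaleC_scaleC scaleC_minus_left scaleC_one)
  then have "(norm w)\<^sup>2 = 1"
    using cstar_identity[of w] assms(4) by simp
  then have "norm w = 1"
    by (simp add: power2_eq_1_iff) (use norm_ge_zero[of w] in linarith)
  moreover have "2 *\<^sub>R h = w + star w"
    unfolding star by (simp add: w_def scaleR_2)
  then have "2 * norm h \<le> norm w + norm (star w)"
    by (metis norm_scaleR norm_triangle_ineq abs_numeral)
  ultimately show ?thesis by simp
qed

text \<open>For \<open>k = h /\<^sub>R s\<close> the root \<open>r\<close> of
  \<open>1 - k * k\<close> commutes with \<open>k\<close>, and \<open>r * r + k * k = 1\<close>; so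
  \<open>norm r \<le> 1\<close>, and \<open>1 - k * k = r * r\<close> has norm at most
  \<open>1\<close>. Scaling by \<open>s * s\<close> gives the claim.\<close>

lemma norm_diff_square_le:
  fixes h :: "'a::{cstar_algebra, real_normed_algebra_1}"
  assumes "star h = h" "norm h \<le> s" "0 < s"
  shows "norm (of_real (s * s) - h * h) \<le> s * s"
proof -
  define k where "k = h /\<^sub>R s"
  have k: "star k = k" "norm k \<le> 1"
    using assms by (simp_all add: k_def star_scaleR divide_simps)
  define u where "u = k * k"
  have u: "norm u \<le> 1"
    using k norm_mult_ineq[of k k] mult_le_one[of "norm k" "norm k"] by (simp add: u_def)
  define r where "r = 1 - sqrt_defect u"
  have "star u = u"
    by (simp add: u_def star_mult k)
  then have "star r = r"
    by (simp add: r_def star_diff star_sqrt_defect u)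
  moreover have "r * r = 1 - u"
    using sqrt_defect_square[OF u] by (simp add: r_def algebra_simps mult_2)
  moreover have "r * k = k * r"
    using intertwine_sqrt_defect[OF u u, of k] by (simp add: r_def u_def algebra_simps)
  ultimately have "norm r \<le> 1"
    using norm_le_1_of_sum_squares[of r k] k by (simp add: u_def)
  then have "norm (1 - u) \<le> 1"
    using norm_mult_ineq[of r r] mult_le_one[of "norm r" "norm r"] \<open>r * r = 1 - u\<close> by simp
  moreover have "of_real (s * s) - h * h = (s * s) *\<^sub>R (1 - u)"
    using assms(3) by (simp add: u_def k_def of_real_def scaleR_diff_right field_simps)
  then have "norm (of_real (s * s) - h * h) = (s * s) * norm (1 - u)"
    by (metis abs_mult_self_eq norm_scaleR abs_mult)
  ultimately show ?thesis
    using assms(3) by (simp add: mult_left_le)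
qed

lemma upos_square:
  assumes "star h = h"
  shows "upos (h * h)"
proof -
  \<comment> \<open>\<open>norm h + 1\<close> in place of \<open>norm h\<close> keeps the scale
    positive also for \<open>h = 0\<close>.\<close>
  have "norm (of_real ((norm h + 1) * (norm h + 1)) - h * h) \<le> (norm h + 1) * (norm h + 1)"
    by (intro norm_diff_square_le assms) (simp_all add: add_nonneg_pos)
  then show ?thesis
    unfolding upos_def star_mult assms by blast
qed

text \<open>Writing \<open>h\<close> as a square shows that every positive \<open>t\<close> above
  the norm can serve in the definition of \<open>upos\<close>, in place of an unknown witness. This
  uniformity is what closedness of the cone needs.\<close>

lemma upos_norm_bound:
  assumes "upos h" "norm h \<le> t" "0 < t"
  shows "norm (of_real t - h) \<le> t"
proof -
  obtain r where "upos r" and r: "star r = r" "r * r = h"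
    using assms(1) by (rule upos_sqrtE)
  have "(norm r)\<^sup>2 \<le> t"
    using cstar_identity[of r] r assms(2) by simp
  then have "norm r \<le> sqrt t"
    by (rule real_le_rsqrt)
  then show ?thesis
    using norm_diff_square_le[OF r(1), of "sqrt t"] r(2) assms(3) by simp
qed

lemma upos_closed:
  assumes "\<And>n. upos (h n)" "h \<longlonglongrightarrow> l"
  shows "upos l"
proof -
  \<comment> \<open>A common norm bound \<open>K\<close> of the convergent sequence works as
    \<open>t\<close> for every term, so the condition passes to the limit.\<close>
  obtain K where K: "0 < K" "\<And>n. norm (h n) \<le> K"
    using Bseq_def convergent_imp_Bseq convergentI[OF assms(2)] by metis
  have "norm (of_real K - l) \<le> K"
  proof (rule LIMSEQ_le_const2)
    show "(\<lambda>n. norm (of_real K - h n)) \<longlonglongrightarrow> norm (of_real K - l)"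
      by (intro tendsto_intros assms(2))
  qed (use upos_norm_bound[OF assms(1) K(2,1)] in auto)
  moreover have "(\<lambda>n. star (h n)) \<longlonglongrightarrow> star l"
    using bounded_linear.tendsto[OF bounded_linear_star assms(2)] .
  then have "star l = l"
    using assms(2) upos_star[OF assms(1)] by (simp add: LIMSEQ_unique)
  ultimately show ?thesis by (auto simp: upos_def)
qed

lemma upos_mult:
  assumes "upos a" "upos b" "a * b = b * a"
  shows "upos (a * b)"
proof -
  obtain r where "upos r" and r: "star r = r" "r * r = a" "\<And>c. a * c = c * a \<Longrightarrow> r * c = c * r"
    using assms(1) by (rule upos_sqrtE) blast
  obtain q where "upos q" and q: "star q = q" "q * q = b" "\<And>c. b * c = c * b \<Longrightarrow> q * c = c * q"
    using assms(2) by (rule upos_sqrtE) blast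
  \<comment> \<open>\<open>r\<close> commutes with \<open>b\<close> because \<open>b\<close>
    commutes with \<open>a\<close>; hence \<open>q\<close>, the root of \<open>b\<close>, commutes
    with \<open>r\<close>.\<close>
  have comm: "q * r = r * q"
    using r(3)[of b] q(3)[of r] assms(3) by simp
  then have "star (r * q) = r * q"
    by (simp add: star_mult r q)
  moreover have "(r * q) * (r * q) = a * b"
    by (metis comm mult.assoc q(2) r(2))
  ultimately show ?thesis
    using upos_square by metis
qed

text \<open>For \<open>y\<close> the rescaled \<open>x\<close>, the product of \<open>1 - y\<close>
  and \<open>1 + y\<close> is positive, and its root \<open>r\<close> satisfies
  \<open>y * y + r * r = 1\<close>; so \<open>norm y \<le> 1\<close>.\<close>

lemma norm_le_of_upos:
  assumes "upos (of_real t - x)" "upos (of_real t + x)" "0 \<le> t"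
  shows "norm x \<le> t"
proof (rule field_le_epsilon)
  fix e :: real assume "e > 0"
  \<comment> \<open>The additional \<open>e\<close> makes the divisor positive when
    \<open>t = 0\<close>.\<close>
  define s where "s = t + e"
  have s: "s > 0" using assms(3) \<open>e > 0\<close> by (simp add: s_def)
  have "upos (of_real s - x)" "upos (of_real s + x)"
    using upos_add[OF assms(1) upos_of_real[of e]] upos_add[OF assms(2) upos_of_real[of e]] \<open>e > 0\<close>
    by (simp_all add: s_def algebra_simps)
  then have pos: "upos ((of_real s - x) /\<^sub>R s)" "upos ((of_real s + x) /\<^sub>R s)"
    using s by (simp_all add: upos_scaleR)
  define y where "y = x /\<^sub>R s"
  have eq: "(of_real s - x) /\<^sub>R s = 1 - y" "(of_real s + x) /\<^sub>R s = 1 + y"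
    using s by (simp_all add: y_def of_real_def scaleR_diff_right scaleR_add_right)
  have "(1 - y) * (1 + y) = (1 + y) * (1 - y)"
    by (simp add: algebra_simps)
  then have "upos ((1 - y) * (1 + y))"
    by (rule upos_mult[OF pos[unfolded eq]])
  moreover have "(1 - y) * (1 + y) = 1 - y * y"
    by (simp add: algebra_simps)
  ultimately have "upos (1 - y * y)"
    by simp
  then obtain r where "upos r" and r: "star r = r" "r * r = 1 - y * y"
      "\<And>c. (1 - y * y) * c = c * (1 - y * y) \<Longrightarrow> r * c = c * r"
    by (rule upos_sqrtE) blast
  have "star y = y"
    using upos_star[OF pos(2)] unfolding eq by (simp add: star_add)
  moreover have "r * y = y * r"
    by (rule r(3)) (simp add: algebra_simps)
  ultimately have "norm y \<le> 1"
    using r(1,2) by (intro norm_le_1_of_sum_squares[of y r]) (auto simp only: diff_add_cancel add_diff_cancel_left' add.commute[of "y * y"])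
  then show "norm x \<le> t + e"
    using s by (simp add: y_def divide_simps flip: s_def)
qed

text \<open>\<open>a\<close> lies between plus and minus \<open>norm (a + b)\<close>, since
  \<open>b\<close> and \<open>norm (a + b) - (a + b)\<close> are positive.\<close>

lemma upos_norm_mono:
  assumes "upos a" "upos b"
  shows "norm a \<le> norm (a + b)"
proof (rule norm_le_of_upos)
  have "upos (of_real (norm (a + b)) - (a + b))"
    using assms by (intro upos_norm_diff) (auto simp: star_add upos_star)
  from upos_add[OF this assms(2)] show "upos (of_real (norm (a + b)) - a)"
    by simp
  show "upos (of_real (norm (a + b)) + a)"
    using assms by (intro upos_add upos_of_real) simp_all
qed simp

lemma upos_antisym: "upos h \<Longrightarrow> upos (- h) \<Longrightarrow> h = 0"
  using upos_norm_mono[of h "- h"] by simp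

section \<open>Uniqueness of positive square roots and positivity of
  \<open>star b * b\<close>\<close>

lemma cube_eq_0:
  assumes "star d = d" "d * d * d = (0::'a::cstar_algebra)"
  shows "d = 0"
proof -
  have "star (d * d) * (d * d) = 0"
    by (simp add: star_mult assms(1) mult.assoc[symmetric] assms(2))
  then show ?thesis
    using star_mult_self_eq_0[of "d * d"] star_mult_self_eq_0[of d] assms(1) by simp
qed

lemma upos_sandwich_commute:
  assumes "upos w" "star d = d" "w * d = d * w"
  shows "upos (d * w * d)"
proof -
  obtain p where "upos p" and p: "star p = p" "p * p = w" "\<And>c. w * c = c * w \<Longrightarrow> p * c = c * p"
    using assms(1) by (rule upos_sqrtE) blast
  have pd: "p * d = d * p"
    using p(3) assms(3) by simp
  have "star (p * d) = p * d"
    by (simp add: star_mult p pd assms(2))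
  moreover have "(p * d) * (p * d) = d * w * d"
    by (metis mult.assoc p(2) pd)
  ultimately show ?thesis
    using upos_square by metis
qed

text \<open>For \<open>d = w - r\<close> the elements \<open>d * w * d\<close> and
  \<open>d * r * d\<close> are positive with sum \<open>d * (w + r) * d = 0\<close>, so both vanish,
  and their difference is \<open>d\<close> cubed. Needed to recognize a positive element as the
  constructed root of its square.\<close>

lemma upos_sqrt_unique:
  assumes "upos w" "upos r" "w * r = r * w" "w * w = r * r"
  shows "w = r"
proof -
  define d where "d = w - r"
  have "star d = d"
    using assms by (simp add: d_def star_diff upos_star)
  moreover have "w * d = d * w" "r * d = d * r"
    using assms(3) by (simp_all add: d_def algebra_simps)
  ultimately have pos: "upos (d * w * d)" "upos (d * r * d)"
    using upos_sandwich_commute assms(1,2) by blast+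
  have "d * (w + r) = 0"
    using assms(3,4) by (simp add: d_def algebra_simps)
  moreover have "d * w * d + d * r * d = d * (w + r) * d"
    by (simp add: distrib_left distrib_right)
  ultimately have "d * w * d + d * r * d = 0"
    by simp
  then have "d * w * d = - (d * r * d)"
    by (simp add: eq_neg_iff_add_eq_0)
  with pos have "d * r * d = 0" "d * w * d = 0"
    using upos_antisym[of "d * r * d"] by simp_all
  then have "d * (w - r) * d = 0"
    by (simp add: left_diff_distrib right_diff_distrib)
  then have "d * d * d = 0"
    by (simp add: d_def)
  then have "d = 0"
    using cube_eq_0 \<open>star d = d\<close> by blast
  then show ?thesis by (simp add: d_def)
qed

text \<open>Kaplansky's argument. With \<open>w = c c\<^sup>*\<close> and \<open>e = - c\<^sup>* c\<close> one has \<open>w c = - c e\<close>, hence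
  \<open>w\<^sup>2 c = c e\<^sup>2\<close>; if \<open>w\<close> and \<open>e\<close> are positive, then taking square roots gives \<open>w c = c e\<close>.\<close>

lemma eq_0_of_upos_minus:
  assumes "upos (- (star c * c))"
  shows "c = 0"
proof -
  define w e where "w = c * star c" and "e = - (star c * c)"
  \<comment> \<open>\<open>x\<close> is twice the real part of \<open>c\<close> and \<open>y\<close>
    minus twice its imaginary part, so \<open>x * x + y * y\<close> is twice
    \<open>star c * c + c * star c\<close>. With \<open>- (star c * c)\<close> positive, this makes
    \<open>c * star c\<close> positive.\<close>
  define x y where "x = c + star c" and "y = \<i> *\<^sub>C (c - star c)"
  have "star x = x" "star y = y"
    by (simp_all add: x_def y_def star_add star_star star_scaleC star_diff scaleC_minus_left
        scaleC_diff_right)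
  then have "upos (x * x + y * y + 2 *\<^sub>R e)"
    using assms by (intro upos_add upos_square upos_scaleR) (simp_all add: e_def)
  moreover have "y * y = - ((c - star c) * (c - star c))"
    by (simp add: y_def scaleC_mult_left scaleC_mult_right scaleC_scaleC scaleC_minus_one)
  then have "x * x + y * y + 2 *\<^sub>R e = 2 *\<^sub>R w"
    by (simp add: x_def w_def e_def scaleR_2 algebra_simps)
  ultimately have "upos (2 *\<^sub>R w)"
    by simp
  then have w: "upos w"
    using upos_scaleR[of "1 / 2" "2 *\<^sub>R w"] by simp
  have e: "upos e" using assms by (simp add: e_def)
  have wc: "w * c = - (c * e)"
    by (simp add: w_def e_def mult.assoc)
  then have wwc: "(w * w) * c = c * (e * e)"
    by (metis minus_mult_left minus_mult_right mult.assoc minus_minus)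
  obtain s where s: "0 < s" "norm (of_real s - w * w) \<le> s"
    using uposE[OF upos_square[OF upos_star[OF w]]] by blast
  obtain t where t: "0 < t" "norm (of_real t - e * e) \<le> t"
    using uposE[OF upos_square[OF upos_star[OF e]]] by blast
  \<comment> \<open>Both square roots have to use the same scale for \<open>intertwine_usqrt\<close>
    to apply.\<close>
  define m where "m = max s t"
  have m: "0 < m" "norm (of_real m - w * w) \<le> m" "norm (of_real m - e * e) \<le> m"
    using norm_of_real_diff_mono[OF s(2), of m] norm_of_real_diff_mono[OF t(2), of m] s(1)
    by (simp_all add: m_def)
  have root: "usqrt m (k * k) = k" if "upos k" "norm (of_real m - k * k) \<le> m" for k
  proof (rule upos_sqrt_unique)
    show "usqrt m (k * k) * k = k * usqrt m (k * k)"
      using intertwine_usqrt[OF m(1) that(2) that(2), of k] by (simp add: mult.assoc)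
  qed (simp_all add: that usqrt[OF m(1)] star_mult upos_star)
  have "w * c = c * e"
    using intertwine_usqrt[OF m wwc] root[OF w m(2)] root[OF e m(3)] by simp
  \<comment> \<open>\<open>w * c\<close> is now both \<open>c * e\<close> and
    \<open>- (c * e)\<close>; and \<open>c * e = 0\<close> kills
    \<open>e * e = - (star c * (c * e))\<close>.\<close>
  then have "c * e + c * e = 0"
    using wc by (metis add.right_inverse)
  then have "c * e = 0"
    by (metis scaleR_2 scaleR_eq_0_iff zero_neq_numeral)
  then have "e * e = 0"
    by (simp add: e_def mult.assoc)
  then have "e = 0"
    using star_mult_self_eq_0[of e] upos_star[OF e] by simp
  then show ?thesis by (simp add: e_def)
qed

text \<open>\<open>m\<close> is the absolute value of \<open>h\<close> and \<open>n\<close> twice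
  its negative part. As \<open>- (star (b * n) * (b * n))\<close> equals \<open>n * m * n\<close>
  and so is positive, \<open>eq_0_of_upos_minus\<close> yields \<open>b * n = 0\<close>; this leaves
  \<open>n * n = 0\<close>, that is, \<open>h = m\<close>.\<close>

lemma upos_star_mult_self: "upos (star b * b)"
proof -
  define h where "h = star b * b"
  have h: "star h = h"
    by (simp add: h_def star_mult star_star)
  obtain m where m: "upos m" "star m = m" "m * m = h * h" "\<And>c. h * h * c = c * (h * h) \<Longrightarrow> m * c = c * m"
    using upos_square[OF h] by (rule upos_sqrtE) blast
  have mh: "m * h = h * m"
    by (rule m(4)) (simp add: mult.assoc)
  define n where "n = m - h"
  have n: "star n = n" "m * n = n * m"
    by (simp_all add: n_def star_diff m h right_diff_distrib left_diff_distrib mh)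
  have hn: "h * n = - (m * n)"
    by (simp add: n_def right_diff_distrib m(3) mh)
  have "- (star (b * n) * (b * n)) = - (n * (h * n))"
    by (simp add: star_mult n h_def mult.assoc)
  also have "\<dots> = n * m * n"
    by (simp add: hn mult.assoc)
  finally have eq: "- (star (b * n) * (b * n)) = n * m * n" .
  then have "b * n = 0"
    using eq_0_of_upos_minus[of "b * n"] upos_sandwich_commute[OF m(1) n] by simp
  then have "h * n = 0"
    by (simp add: h_def mult.assoc)
  then have "n * n = 0"
    using hn by (simp add: n_def[symmetric] left_diff_distrib) (simp add: n_def left_diff_distrib)
  then have "n = 0"
    using star_mult_self_eq_0[of n] n by simp
  then show ?thesis
    using m(1) by (simp add: n_def h_def)
qed

lemma upos_conj:
  assumes "upos h"
  shows "upos (star c * h * c)"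
proof -
  obtain r where "star r = r" "r * r = h"
    using assms by (rule upos_sqrtE)
  then have "star c * h * c = star (r * c) * (r * c)"
    by (simp add: star_mult mult.assoc) (simp add: mult.assoc[symmetric])
  then show ?thesis by (simp only: upos_star_mult_self)
qed

section \<open>The positive cone of a C*-algebra\<close>

lemma Unital_add: "Unital a 0 + Unital b 0 = Unital (a + b) 0"
  and Unital_diff: "Unital a 0 - Unital b 0 = Unital (a - b) 0"
  and Unital_mult: "Unital a 0 * Unital b 0 = Unital (a * b) 0"
  and Unital_scaleR: "r *\<^sub>R Unital a 0 = Unital (r *\<^sub>R a) 0"
  and Unital_star: "star (Unital a 0) = Unital (star a) 0"
  by (simp_all add: plus_unital_def minus_unital_def times_unital_def scaleR_unital_def
      scaleC_unital_def star_unital_def scaleC_of_real)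

lemma norm_Unital [simp]: "norm (Unital a 0) = norm a"
  by (simp add: norm_unital_def onorm_uop_alg)

text \<open>The root \<open>r\<close> of an element of the original algebra stays in that algebra,
  since its scalar part squares to \<open>0\<close>. So facts on \<open>upos\<close> in the
  unitization descend to the algebraic cone.\<close>

lemma cpos_iff_upos: "cpos a \<longleftrightarrow> upos (Unital a 0)"
proof
  assume "cpos a"
  then obtain b where "a = star b * b"
    by (auto simp: cpos_def)
  then show "upos (Unital a 0)"
    using upos_star_mult_self[of "Unital b 0"] by (simp add: Unital_mult Unital_star)
next
  assume "upos (Unital a 0)"
  then obtain r where "upos r" and r: "star r = r" "r * r = Unital a 0"
    by (rule upos_sqrtE)
  have "scal (r * r) = 0"
    by (simp only: r unital.sel)
  then have "r = Unital (alg r) 0"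
    by (cases r) simp
  then obtain b where "r = Unital b 0" by blast
  with r show "cpos a"
    unfolding cpos_def by (auto simp: Unital_mult Unital_star intro!: exI[of _ b])
qed

lemma cpos_star_mult_self [simp]: "cpos (star b * b)"
  by (auto simp: cpos_def)

lemma cpos_0 [simp]: "cpos 0"
  using cpos_star_mult_self[of 0] by simp

lemma cpos_add: "cpos a \<Longrightarrow> cpos b \<Longrightarrow> cpos (a + b)"
  using upos_add[of "Unital a 0" "Unital b 0"] by (simp add: cpos_iff_upos Unital_add)

lemma cpos_sum: "(\<And>i. i \<in> I \<Longrightarrow> cpos (f i)) \<Longrightarrow> cpos (sum f I)"
  by (induction I rule: infinite_finite_induct) (auto intro: cpos_add)

lemma cpos_scaleR: "0 \<le> r \<Longrightarrow> cpos a \<Longrightarrow> cpos (r *\<^sub>R a)"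
  using upos_scaleR[of r "Unital a 0"] by (simp add: cpos_iff_upos Unital_scaleR)

lemma cpos_norm_mono: "cpos a \<Longrightarrow> cpos b \<Longrightarrow> norm a \<le> norm (a + b)"
  using upos_norm_mono[of "Unital a 0" "Unital b 0"] by (simp add: cpos_iff_upos Unital_add)

lemma cpos_closed:
  assumes "\<And>n. cpos (h n)" "h \<longlonglongrightarrow> l"
  shows "cpos l"
  unfolding cpos_iff_upos
proof (rule upos_closed)
  show "upos (Unital (h n) 0)" for n
    using assms(1) by (simp add: cpos_iff_upos)
  have "(\<lambda>n. norm (Unital (h n) 0 - Unital l 0)) \<longlonglongrightarrow> 0"
    using assms(2) by (simp add: Unital_diff LIM_zero tendsto_norm_zero)
  then show "(\<lambda>n. Unital (h n) 0) \<longlonglongrightarrow> Unital l 0"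
    by (rule tendsto_norm_zero_cancel[THEN LIM_zero_cancel])
qed

lemma cpos_suminf: "summable f \<Longrightarrow> (\<And>n. cpos (f n)) \<Longrightarrow> cpos (suminf f)"
  by (rule cpos_closed[OF _ summable_LIMSEQ]) (auto intro: cpos_sum)

text \<open>The element \<open>norm h - h\<close> is formed in the unitization; conjugation with
  \<open>c\<close> brings it back into the algebra.\<close>

lemma cpos_conj_norm:
  assumes "star h = h"
  shows "cpos (norm h *\<^sub>R (star c * c) - star c * h * c)"
proof -
  let ?h = "Unital h 0" and ?c = "Unital c 0"
  have "upos (star ?c * (of_real (norm h) - ?h) * ?c)"
    by (intro upos_conj upos_norm_diff) (simp_all add: Unital_star assms)
  also have "star ?c * (of_real (norm h) - ?h) * ?c = norm h *\<^sub>R (star ?c * ?c) - star ?c * ?h * ?c"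
    by (simp add: of_real_def left_diff_distrib right_diff_distrib)
  finally show ?thesis
    by (simp add: cpos_iff_upos Unital_star Unital_mult Unital_scaleR Unital_diff)
qed

section \<open>Inner product modules\<close>

lemma norm_le_of_cpos_diff: "cpos a \<Longrightarrow> cpos (b - a) \<Longrightarrow> norm a \<le> norm b"
  using cpos_norm_mono[of a "b - a"] by simp

text \<open>Completeness is left out in order to have \<^const>\<open>l2\<close> as an instance without proving it complete.\<close>

locale pre_hilbert_module =
  fixes X :: "('a::cstar_algebra, 'x::complex_vector) hmod"
  assumes zero_closed: "0 \<in> hcarrier X"
    and add_closed: "x \<in> hcarrier X \<Longrightarrow> y \<in> hcarrier X \<Longrightarrow> x + y \<in> hcarrier X"
    and scaleC_closed: "x \<in> hcarrier X \<Longrightarrow> c *\<^sub>C x \<in> hcarrier X"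
    and act_closed: "x \<in> hcarrier X \<Longrightarrow> hact X x a \<in> hcarrier X"
    and inner_add_right: "x \<in> hcarrier X \<Longrightarrow> y \<in> hcarrier X \<Longrightarrow> z \<in> hcarrier X \<Longrightarrow>
          hinner X x (y + z) = hinner X x y + hinner X x z"
    and inner_scaleC_right: "x \<in> hcarrier X \<Longrightarrow> y \<in> hcarrier X \<Longrightarrow>
          hinner X x (c *\<^sub>C y) = c *\<^sub>C hinner X x y"
    and inner_act_right: "x \<in> hcarrier X \<Longrightarrow> y \<in> hcarrier X \<Longrightarrow>
          hinner X x (hact X y a) = hinner X x y * a"
    and inner_star: "x \<in> hcarrier X \<Longrightarrow> y \<in> hcarrier X \<Longrightarrow>
          star (hinner X x y) = hinner X y x"
    and inner_pos: "x \<in> hcarrier X \<Longrightarrow> cpos (hinner X x x)"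
    and inner_definite: "x \<in> hcarrier X \<Longrightarrow> hinner X x x = 0 \<Longrightarrow> x = 0"
begin

lemma minus_closed: "x \<in> hcarrier X \<Longrightarrow> - x \<in> hcarrier X"
  using scaleC_closed[of x "- 1"] by (simp add: scaleC_minus_one)

lemma diff_closed: "x \<in> hcarrier X \<Longrightarrow> y \<in> hcarrier X \<Longrightarrow> x - y \<in> hcarrier X"
  using add_closed[of x "- y"] by (simp add: minus_closed)

lemma sum_closed: "(\<And>i. i \<in> I \<Longrightarrow> f i \<in> hcarrier X) \<Longrightarrow> sum f I \<in> hcarrier X"
  by (induction I rule: infinite_finite_induct) (auto intro: zero_closed add_closed)

lemmas closed = zero_closed add_closed scaleC_closed act_closed minus_closed diff_closed

lemma inner_add_left: "x \<in> hcarrier X \<Longrightarrow> y \<in> hcarrier X \<Longrightarrow> z \<in> hcarrier X \<Longrightarrow>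
    hinner X (x + y) z = hinner X x z + hinner X y z"
  using inner_add_right[of z x y] inner_star[of z "x + y"] inner_star[of z x] inner_star[of z y]
  by (simp add: add_closed star_add)

lemma inner_scaleC_left: "x \<in> hcarrier X \<Longrightarrow> y \<in> hcarrier X \<Longrightarrow>
    hinner X (c *\<^sub>C x) y = cnj c *\<^sub>C hinner X x y"
  using inner_scaleC_right[of y x c] inner_star[of y "c *\<^sub>C x"] inner_star[of y x]
  by (simp add: scaleC_closed star_scaleC)

lemma inner_act_left: "x \<in> hcarrier X \<Longrightarrow> y \<in> hcarrier X \<Longrightarrow>
    hinner X (hact X x a) y = star a * hinner X x y"
  using inner_act_right[of y x a] inner_star[of y "hact X x a"] inner_star[of y x]
  by (simp add: act_closed star_mult)

lemma inner_minus_right: "x \<in> hcarrier X \<Longrightarrow> y \<in> hcarrier X \<Longrightarrow> hinner X x (- y) = - hinner X x y"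
  using inner_scaleC_right[of x y "- 1"] by (simp add: scaleC_minus_one)

lemma inner_minus_left: "x \<in> hcarrier X \<Longrightarrow> y \<in> hcarrier X \<Longrightarrow> hinner X (- x) y = - hinner X x y"
  using inner_scaleC_left[of x y "- 1"] by (simp add: scaleC_minus_one)

lemma inner_diff_right: "x \<in> hcarrier X \<Longrightarrow> y \<in> hcarrier X \<Longrightarrow> z \<in> hcarrier X \<Longrightarrow>
    hinner X x (y - z) = hinner X x y - hinner X x z"
  using inner_add_right[of x y "- z"] by (simp add: closed inner_minus_right)

lemma inner_diff_left: "x \<in> hcarrier X \<Longrightarrow> y \<in> hcarrier X \<Longrightarrow> z \<in> hcarrier X \<Longrightarrow>
    hinner X (x - y) z = hinner X x z - hinner X y z"
  using inner_add_left[of x "- y" z] by (simp add: closed inner_minus_left)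

lemma inner_zero_right: "x \<in> hcarrier X \<Longrightarrow> hinner X x 0 = 0"
  using inner_diff_right[of x 0 0] by (simp add: closed)

lemma inner_sum_right: "x \<in> hcarrier X \<Longrightarrow> (\<And>i. i \<in> I \<Longrightarrow> f i \<in> hcarrier X) \<Longrightarrow>
    hinner X x (sum f I) = (\<Sum>i\<in>I. hinner X x (f i))"
  by (induction I rule: infinite_finite_induct)
    (simp_all add: inner_zero_right inner_add_right sum_closed)

lemmas inner_simps = inner_add_right inner_add_left inner_diff_right inner_diff_left
  inner_scaleC_right inner_scaleC_left inner_act_right inner_act_left

lemma inner_ext:
  assumes "x \<in> hcarrier X" "y \<in> hcarrier X" "\<And>z. z \<in> hcarrier X \<Longrightarrow> hinner X z x = hinner X z y"
  shows "x = y"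
proof -
  have "hinner X (x - y) (x - y) = 0"
    using assms by (simp add: inner_diff_right closed)
  then show ?thesis
    using inner_definite[of "x - y"] assms by (simp add: closed)
qed

lemma hnorm_nonneg [simp]: "0 \<le> hnorm X x"
  by (simp add: hnorm_def)

lemma hnorm_square: "(hnorm X x)\<^sup>2 = norm (hinner X x x)"
  by (simp add: hnorm_def)

lemma hnorm_eq_0: "x \<in> hcarrier X \<Longrightarrow> hnorm X x = 0 \<longleftrightarrow> x = 0"
  using inner_definite[of x] by (auto simp: hnorm_def inner_zero_right closed)

lemma hnorm_scaleC: "x \<in> hcarrier X \<Longrightarrow> hnorm X (c *\<^sub>C x) = cmod c * hnorm X x"
  by (simp add: hnorm_def inner_simps closed norm_scaleC real_sqrt_mult mult.assoc[symmetric])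

lemma hnorm_minus: "x \<in> hcarrier X \<Longrightarrow> hnorm X (- x) = hnorm X x"
  using hnorm_scaleC[of x "- 1"] by (simp add: scaleC_minus_one)

lemma hnorm_minus_commute: "x \<in> hcarrier X \<Longrightarrow> y \<in> hcarrier X \<Longrightarrow> hnorm X (x - y) = hnorm X (y - x)"
  using hnorm_minus[of "x - y"] by (simp add: closed)

lemma norm_inner_le:
  assumes x: "x \<in> hcarrier X" and y: "y \<in> hcarrier X"
  shows "norm (hinner X x y) \<le> hnorm X x * hnorm X y"
proof (cases "hinner X y y = 0")
  case True
  then show ?thesis
    using inner_definite[OF y] x by (simp add: inner_zero_right)
next
  case False
  define n where "n = norm (hinner X y y)"
  have n: "n > 0" using False by (simp add: n_def)
  define a where "a = hinner X y x"
  have star_a: "star a = hinner X x y"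
    by (simp add: a_def inner_star x y)
  \<comment> \<open>The vector \<open>x - y a / n\<close> of the Cauchy-Schwarz proof, multiplied by
    \<open>n\<close>; the norm \<open>n\<close> replaces \<open>hinner X y y\<close>, which need not
    be invertible.\<close>
  define z where "z = complex_of_real n *\<^sub>C x - hact X y a"
  have zz: "hinner X z z = n *\<^sub>R n *\<^sub>R hinner X x x - n *\<^sub>R (star a * a) - n *\<^sub>R (star a * a)
      + star a * hinner X y y * a"
    by (simp add: z_def inner_simps closed x y star_a[symmetric] a_def[symmetric] scaleC_of_real
        scaleC_scaleC mult.assoc scaleR_diff_right scaleC_mult_right scaleC_mult_left algebra_simps)
  have "cpos (hinner X z z)"
    by (intro inner_pos) (simp add: z_def closed x y)
  then have "cpos (hinner X z z + (n *\<^sub>R (star a * a) - star a * hinner X y y * a))"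
    unfolding n_def by (intro cpos_add cpos_conj_norm inner_star y)
  then have "cpos (n *\<^sub>R n *\<^sub>R hinner X x x - n *\<^sub>R (star a * a))"
    by (simp add: zz)
  then have "cpos (inverse n *\<^sub>R (n *\<^sub>R n *\<^sub>R hinner X x x - n *\<^sub>R (star a * a)))"
    using n by (intro cpos_scaleR) simp_all
  then have "cpos (n *\<^sub>R hinner X x x - star a * a)"
    using n by (simp add: scaleR_diff_right mult.assoc[symmetric])
  then have "norm (star a * a) \<le> norm (n *\<^sub>R hinner X x x)"
    by (rule norm_le_of_cpos_diff[rotated]) simp
  then have "(norm a)\<^sup>2 \<le> n * norm (hinner X x x)"
    using n by (simp add: cstar_identity)
  also have "\<dots> = (hnorm X x * hnorm X y)\<^sup>2"
    by (simp add: power_mult_distrib hnorm_square n_def)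
  finally have "norm a \<le> hnorm X x * hnorm X y"
    by (rule power2_le_imp_le) simp
  then show ?thesis
    using norm_star[of a] star_a by simp
qed

lemma hnorm_triangle:
  assumes "x \<in> hcarrier X" "y \<in> hcarrier X"
  shows "hnorm X (x + y) \<le> hnorm X x + hnorm X y"
proof (rule power2_le_imp_le)
  have "norm (hinner X (x + y) (x + y)) \<le> norm (hinner X x x) + norm (hinner X x y)
      + (norm (hinner X y x) + norm (hinner X y y))"
    unfolding inner_add_left[OF assms add_closed[OF assms]] inner_add_right[OF assms(1) assms]
      inner_add_right[OF assms(2) assms]
    by (intro norm_triangle_le add_mono norm_triangle_ineq)
  then show "(hnorm X (x + y))\<^sup>2 \<le> (hnorm X x + hnorm X y)\<^sup>2"
    using norm_inner_le[OF assms] norm_inner_le[OF assms(2,1)]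
    by (simp add: power2_sum hnorm_square mult.commute[of "hnorm X y"])
qed simp

lemma hnorm_triangle_diff:
  assumes "x \<in> hcarrier X" "y \<in> hcarrier X" "z \<in> hcarrier X"
  shows "hnorm X (x - z) \<le> hnorm X (x - y) + hnorm X (y - z)"
  using hnorm_triangle[of "x - y" "y - z"] assms by (simp add: closed)

lemma hlim_inner:
  assumes "\<And>n. s n \<in> hcarrier X" "l \<in> hcarrier X" "z \<in> hcarrier X" "hlim X s l"
  shows "(\<lambda>n. hinner X z (s n)) \<longlonglongrightarrow> hinner X z l"
proof (rule LIM_zero_cancel, rule Lim_null_comparison)
  show "\<forall>\<^sub>F n in sequentially. norm (hinner X z (s n) - hinner X z l) \<le> hnorm X z * hnorm X (s n - l)"
    using norm_inner_le[of z "s _ - l"] assms by (simp add: inner_diff_right closed)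
  show "(\<lambda>n. hnorm X z * hnorm X (s n - l)) \<longlonglongrightarrow> 0"
    using assms(4) unfolding hlim_def by (rule tendsto_mult_right_zero)
qed

text \<open>Averaging positivity of \<open>\<langle>x - R x, x - R x\<rangle>\<close> with the claim
  for \<open>R \<circ> R\<close> halves the error \<open>e\<close>, so the induction generalizes
  over \<open>R\<close>. At \<open>n = 0\<close> the error cancels the whole difference.\<close>

lemma self_adjoint_contraction_aux:
  assumes x: "x \<in> hcarrier X"
  shows "(\<And>y. y \<in> hcarrier X \<Longrightarrow> R y \<in> hcarrier X) \<Longrightarrow>
    (\<And>y z. y \<in> hcarrier X \<Longrightarrow> z \<in> hcarrier X \<Longrightarrow> hinner X (R y) z = hinner X y (R z)) \<Longrightarrow>
    (\<And>y. y \<in> hcarrier X \<Longrightarrow> hnorm X (R y) \<le> hnorm X y) \<Longrightarrow>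
    \<exists>e. norm e \<le> 2 * (hnorm X x)\<^sup>2 / 2 ^ n \<and> cpos (hinner X x x - hinner X x (R x) + e)"
proof (induction n arbitrary: R)
  case 0
  have "norm (hinner X x (R x)) \<le> hnorm X x * hnorm X x"
    by (rule order_trans[OF norm_inner_le]) (use 0 x in \<open>auto intro: mult_left_mono\<close>)
  then have "norm (- (hinner X x x - hinner X x (R x))) \<le> 2 * (hnorm X x)\<^sup>2 / 2 ^ 0"
    using norm_triangle_ineq4[of "hinner X x x" "hinner X x (R x)"]
    by (simp add: hnorm_square[symmetric] norm_minus_commute power2_eq_square)
  then show ?case
    by (intro exI[of _ "- (hinner X x x - hinner X x (R x))"]) simp
next
  case (Suc n)
  note R = Suc.prems
  have "\<exists>e. norm e \<le> 2 * (hnorm X x)\<^sup>2 / 2 ^ n \<and> cpos (hinner X x x - hinner X x (R (R x)) + e)"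
  proof (rule Suc.IH)
    show "hnorm X (R (R y)) \<le> hnorm X y" if "y \<in> hcarrier X" for y
      using R(3)[of "R y"] R(3)[of y] R(1) that by fastforce
  qed (use R in auto)
  then obtain e where e: "norm e \<le> 2 * (hnorm X x)\<^sup>2 / 2 ^ n"
      "cpos (hinner X x x - hinner X x (R (R x)) + e)"
    by blast
  have "cpos (hinner X (x - R x) (x - R x))"
    by (intro inner_pos) (simp add: closed R x)
  also have "hinner X (x - R x) (x - R x)
      = hinner X x x - hinner X x (R x) - (hinner X x (R x) - hinner X x (R (R x)))"
    by (simp add: inner_diff_left inner_diff_right closed R x)
  finally have "cpos ((1 / 2) *\<^sub>R ((hinner X x x - hinner X x (R x) -
      (hinner X x (R x) - hinner X x (R (R x)))) + (hinner X x x - hinner X x (R (R x)) + e)))"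
    by (intro cpos_scaleR cpos_add e) simp_all
  also have "(1 / 2) *\<^sub>R ((hinner X x x - hinner X x (R x) -
      (hinner X x (R x) - hinner X x (R (R x)))) + (hinner X x x - hinner X x (R (R x)) + e))
      = (1 / 2) *\<^sub>R (2 *\<^sub>R (hinner X x x - hinner X x (R x)) + e)"
    by (simp add: scaleR_2)
  also have "\<dots> = hinner X x x - hinner X x (R x) + (1 / 2) *\<^sub>R e"
    unfolding scaleR_add_right by simp
  finally show ?case
    using e(1) by (intro exI[of _ "(1 / 2) *\<^sub>R e"]) (simp add: mult.commute)
qed

text \<open>Iterates \<open>2 \<langle>x, R x\<rangle> \<le> \<langle>x, x\<rangle> + \<langle>x, R\<^sup>2 x\<rangle>\<close> over the powers \<open>R, R\<^sup>2, R\<^sup>4, \<dots>\<close>.\<close>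

lemma inner_self_adjoint_contraction_le:
  assumes "x \<in> hcarrier X" "\<And>y. y \<in> hcarrier X \<Longrightarrow> R y \<in> hcarrier X"
    "\<And>y z. y \<in> hcarrier X \<Longrightarrow> z \<in> hcarrier X \<Longrightarrow> hinner X (R y) z = hinner X y (R z)"
    "\<And>y. y \<in> hcarrier X \<Longrightarrow> hnorm X (R y) \<le> hnorm X y"
  shows "cpos (hinner X x x - hinner X x (R x))"
proof -
  have "\<exists>e. norm e \<le> 2 * (hnorm X x)\<^sup>2 / 2 ^ n \<and> cpos (hinner X x x - hinner X x (R x) + e)" for n
    by (rule self_adjoint_contraction_aux[OF assms])
  then obtain e where e: "\<And>n. norm (e n) \<le> 2 * (hnorm X x)\<^sup>2 / 2 ^ n"
      "\<And>n. cpos (hinner X x x - hinner X x (R x) + e n)"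
    by metis
  have "(\<lambda>n. 2 * (hnorm X x)\<^sup>2 / 2 ^ n) \<longlonglongrightarrow> 0"
    by (rule LIMSEQ_divide_realpow_zero) simp
  then have "e \<longlonglongrightarrow> 0"
    by (rule Lim_null_comparison[rotated]) (simp add: e(1))
  then have "(\<lambda>n. hinner X x x - hinner X x (R x) + e n) \<longlonglongrightarrow> hinner X x x - hinner X x (R x) + 0"
    by (intro tendsto_intros)
  then show ?thesis
    using cpos_closed[OF e(2)] by simp
qed

end

lemma (in hilbert_module) pre_hilbert_module: "pre_hilbert_module X"
  by (rule pre_hilbert_module.intro)
    (fact zero_closed add_closed scaleC_closed act_closed inner_add_right inner_scaleC_right
      inner_act_right inner_star inner_pos inner_definite)+

lemma pre_hilbert_module_cstar_mod: "pre_hilbert_module cstar_mod"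
  by unfold_locales
    (auto simp: cstar_mod_def distrib_left scaleC_mult_right mult.assoc star_mult star_star)

section \<open>The standard module\<close>

text \<open>Convergence of \<open>g\<close> need not be absolute, so the comparison is made on
  blocks of the series, using that the norm is monotone on the cone.\<close>

lemma summable_cpos_comparison:
  fixes f g :: "nat \<Rightarrow> 'a::cstar_algebra"
  assumes "summable g" "\<And>n. cpos (f n)" "\<And>n. cpos (g n - f n)"
  shows "summable f"
  unfolding summable_Cauchy
proof (intro allI impI)
  fix e :: real assume "e > 0"
  then obtain N where N: "\<And>m n. m \<ge> N \<Longrightarrow> norm (sum g {m..<n}) < e"
    using assms(1) unfolding summable_Cauchy by blast
  have "norm (sum f {m..<n}) \<le> norm (sum g {m..<n})" for m n
    by (rule norm_le_of_cpos_diff)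
      (auto simp: sum_subtractf[symmetric] intro!: cpos_sum assms)
  then show "\<exists>N. \<forall>m\<ge>N. \<forall>n. norm (sum f {m..<n}) < e"
    using N by (meson order_le_less_trans)
qed

lemma bounded_linear_scaleC: "bounded_linear (\<lambda>x. c *\<^sub>C (x::'a::cstar_algebra))"
  by (rule bounded_linear_intro[where K = "cmod c"])
    (simp_all add: scaleC_add_right scaleC_scaleR norm_scaleC)

lemma l2_carrier: "a \<in> hcarrier l2 \<longleftrightarrow> summable (\<lambda>n. star (a n) * a n)"
  and l2_act: "hact l2 a c = (\<lambda>n. a n * c)"
  and l2_inner: "hinner l2 a b = (\<Sum>n. star (a n) * b n)"
  by (simp_all add: l2_def)

text \<open>The parallelogram law: the terms of \<open>a + b\<close> differ from twice those of
  \<open>a\<close> plus twice those of \<open>b\<close> by a positive element, built from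
  \<open>a n - b n\<close>.\<close>

lemma l2_add_closed:
  assumes "a \<in> hcarrier l2" "b \<in> hcarrier l2"
  shows "a + b \<in> hcarrier l2"
  unfolding l2_carrier
proof (rule summable_cpos_comparison)
  show "summable (\<lambda>n. 2 *\<^sub>R (star (a n) * a n) + 2 *\<^sub>R (star (b n) * b n))"
    using assms by (intro summable_add summable_scaleR_right) (simp_all add: l2_carrier)
  have "2 *\<^sub>R (star (a n) * a n) + 2 *\<^sub>R (star (b n) * b n) - star ((a + b) n) * (a + b) n
      = star (a n - b n) * (a n - b n)" for n
    by (simp add: scaleR_2 star_add star_diff algebra_simps)
  then show "cpos (2 *\<^sub>R (star (a n) * a n) + 2 *\<^sub>R (star (b n) * b n) - star ((a + b) n) * (a + b) n)" for n
    by simp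
qed simp

lemma l2_scaleC_closed: "a \<in> hcarrier l2 \<Longrightarrow> c *\<^sub>C a \<in> hcarrier l2"
  using bounded_linear.summable[OF bounded_linear_scaleC[of "c * cnj c"]]
  by (simp add: l2_carrier scaleC_fun_def star_scaleC scaleC_mult_left scaleC_mult_right scaleC_scaleC)

text \<open>Polarization: \<open>star (a n) * b n\<close> is a combination of the four series
  \<open>d c\<close> with \<open>c\<close> among \<open>1, -1, \<i>, -\<i>\<close>, each summable
  because \<open>l2\<close> is closed under sums and scalars.\<close>

lemma summable_l2_inner:
  assumes "a \<in> hcarrier l2" "b \<in> hcarrier l2"
  shows "summable (\<lambda>n. star (a n) * b n)"
proof -
  define d where "d c n = star ((a + c *\<^sub>C b) n) * (a + c *\<^sub>C b) n" for c n
  have d: "summable (d c)" for c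
    using l2_add_closed[OF assms(1) l2_scaleC_closed[OF assms(2), of c]]
    by (simp add: l2_carrier d_def[abs_def])
  have "summable (\<lambda>n. (1 / 4) *\<^sub>R ((d 1 n - d (- 1) n) - \<i> *\<^sub>C (d \<i> n - d (- \<i>) n)))"
    by (intro summable_scaleR_right summable_diff d bounded_linear.summable[OF bounded_linear_scaleC])
  moreover have "(d 1 n - d (- 1) n) - \<i> *\<^sub>C (d \<i> n - d (- \<i>) n) = 4 *\<^sub>R (star (a n) * b n)" for n
  proof -
    have "d 1 n - d (- 1) n = 2 *\<^sub>R (star (a n) * b n + star (b n) * a n)"
      by (simp add: d_def scaleC_fun_def scaleC_one scaleC_minus_left star_add star_diff
          scaleR_2 algebra_simps)
    moreover have "d \<i> n - d (- \<i>) n = 2 *\<^sub>R \<i> *\<^sub>C (star (a n) * b n - star (b n) * a n)"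
      by (simp add: d_def scaleC_fun_def scaleC_minus_left star_add star_diff star_scaleC
          scaleR_2 scaleC_mult_left scaleC_mult_right scaleC_diff_right scaleC_add_right algebra_simps)
    then have "\<i> *\<^sub>C (d \<i> n - d (- \<i>) n) = - (2 *\<^sub>R (star (a n) * b n - star (b n) * a n))"
      by (simp add: scaleC_scaleR scaleC_scaleC scaleC_minus_one scaleR_minus_right[symmetric] del: scaleR_minus_right)
    moreover have "4 *\<^sub>R x = 2 *\<^sub>R x + 2 *\<^sub>R x" for x :: 'a
      using scaleR_add_left[of 2 2 x] by simp
    ultimately show ?thesis
      by (simp add: scaleR_add_right scaleR_diff_right)
  qed
  ultimately show ?thesis by simp
qed

lemma pre_hilbert_module_l2: "pre_hilbert_module (l2 :: ('a::cstar_algebra, nat \<Rightarrow> 'a) hmod)"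
proof
  fix x y z :: "nat \<Rightarrow> 'a" and c a
  show "0 \<in> hcarrier (l2 :: ('a, nat \<Rightarrow> 'a) hmod)"
    by (simp add: l2_carrier zero_fun_def)
  assume x: "x \<in> hcarrier l2"
  show "c *\<^sub>C x \<in> hcarrier l2"
    by (rule l2_scaleC_closed[OF x])
  have "summable (\<lambda>n. star a * (star (x n) * x n * a))"
    using x by (intro summable_mult summable_mult2) (simp add: l2_carrier)
  then show "hact l2 x a \<in> hcarrier l2"
    by (simp add: l2_carrier l2_act star_mult mult.assoc)
  show pos: "cpos (hinner l2 x x)"
    using x by (auto simp: l2_inner l2_carrier intro!: cpos_suminf)
  show "x = 0" if "hinner l2 x x = 0"
  proof
    fix k
    have s: "summable (\<lambda>n. star (x n) * x n)" using x by (simp add: l2_carrier)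
    \<comment> \<open>The series without its \<open>k\<close>-th term still has a positive sum, so
      that term is dominated by \<open>hinner l2 x x\<close>.\<close>
    define f where "f n = (if n = k then 0 else star (x n) * x n)" for n
    have eq: "f = (\<lambda>n. star (x n) * x n - (if n = k then star (x k) * x k else 0))"
      by (auto simp: f_def)
    have "f sums (hinner l2 x x - star (x k) * x k)"
      unfolding eq l2_inner by (intro sums_diff summable_sums s sums_single)
    moreover have "cpos (f n)" for n
      by (simp add: f_def)
    ultimately have "cpos (hinner l2 x x - star (x k) * x k)"
      by (metis cpos_suminf sums_iff)
    then have "norm (star (x k) * x k) \<le> norm (hinner l2 x x)"
      by (rule norm_le_of_cpos_diff[rotated]) simp
    then show "x k = 0 k" by (simp add: that)
  qed
  assume y: "y \<in> hcarrier l2"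
  show "x + y \<in> hcarrier l2"
    by (rule l2_add_closed[OF x y])
  note xy = summable_l2_inner[OF x y]
  show "hinner l2 x (c *\<^sub>C y) = c *\<^sub>C hinner l2 x y"
    using bounded_linear.suminf[OF bounded_linear_scaleC xy, of c]
    by (simp add: l2_inner scaleC_fun_def scaleC_mult_right)
  show "hinner l2 x (hact l2 y a) = hinner l2 x y * a"
    using suminf_mult2[OF xy, of a] by (simp add: l2_inner l2_act mult.assoc)
  show "star (hinner l2 x y) = hinner l2 y x"
    using bounded_linear.suminf[OF bounded_linear_star xy] by (simp add: l2_inner star_mult star_star)
  assume z: "z \<in> hcarrier l2"
  show "hinner l2 x (y + z) = hinner l2 x y + hinner l2 x z"
    using suminf_add[OF xy summable_l2_inner[OF x z]] by (simp add: l2_inner distrib_left)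
qed

interpretation l2: pre_hilbert_module l2
  by (rule pre_hilbert_module_l2)

definition l2_single :: "nat \<Rightarrow> 'a \<Rightarrow> nat \<Rightarrow> 'a::cstar_algebra"
  where "l2_single n a = (\<lambda>k. if k = n then a else 0)"

definition l2_trunc :: "nat \<Rightarrow> (nat \<Rightarrow> 'a) \<Rightarrow> nat \<Rightarrow> 'a::cstar_algebra"
  where "l2_trunc N a = (\<lambda>k. if k < N then a k else 0)"

lemma l2_single_closed: "l2_single n a \<in> hcarrier l2"
  unfolding l2_carrier l2_single_def by (rule summable_finite[of "{n}"]) auto

lemma l2_trunc_closed: "l2_trunc N a \<in> hcarrier l2"
  unfolding l2_carrier l2_trunc_def by (rule summable_finite[of "{..<N}"]) auto

lemma l2_inner_single: "hinner l2 (l2_single n a) b = star a * b n"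
  unfolding l2_inner by (subst suminf_finite[of "{n}"]) (auto simp: l2_single_def)

lemma l2_inner_trunc: "hinner l2 b (l2_trunc N a) = (\<Sum>n<N. star (b n) * a n)"
  unfolding l2_inner by (subst suminf_finite[of "{..<N}"]) (auto simp: l2_trunc_def)

lemma hlim_l2_trunc:
  assumes "a \<in> hcarrier l2"
  shows "hlim l2 (\<lambda>N. l2_trunc N a) a"
proof -
  let ?q = "\<lambda>n. star (a n) * a n"
  have s: "summable ?q" using assms by (simp add: l2_carrier)
  have "hinner l2 (l2_trunc N a - a) (l2_trunc N a - a) = suminf ?q - (\<Sum>n<N. ?q n)" for N
  proof -
    have "?q sums suminf ?q" "(\<lambda>n. if n \<in> {..<N} then ?q n else 0) sums (\<Sum>n<N. ?q n)"
      by (rule summable_sums[OF s]) (rule sums_If_finite_set, simp)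
    then have "(\<lambda>n. ?q n - (if n \<in> {..<N} then ?q n else 0)) sums (suminf ?q - (\<Sum>n<N. ?q n))"
      by (rule sums_diff)
    also have "(\<lambda>n. ?q n - (if n \<in> {..<N} then ?q n else 0))
        = (\<lambda>n. star ((l2_trunc N a - a) n) * (l2_trunc N a - a) n)"
      by (auto simp: l2_trunc_def)
    finally show ?thesis
      unfolding l2_inner by (simp add: sums_iff)
  qed
  moreover have "(\<lambda>N. sqrt (norm (suminf ?q - (\<Sum>n<N. ?q n)))) \<longlonglongrightarrow> sqrt (norm (suminf ?q - suminf ?q))"
    by (intro tendsto_intros summable_LIMSEQ s)
  ultimately show ?thesis
    by (simp add: hlim_def hnorm_def)
qed

section \<open>Adjointable operators\<close>

lemma (in pre_hilbert_module) hnorm_zero [simp]: "hnorm X 0 = 0"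
  using hnorm_eq_0[of 0] closed by simp

locale adjoint_pair =
  X: pre_hilbert_module X + Y: pre_hilbert_module Y
  for X :: "('a::cstar_algebra, 'x::complex_vector) hmod"
    and Y :: "('a, 'y::complex_vector) hmod" +
  fixes T :: "'x \<Rightarrow> 'y" and S :: "'y \<Rightarrow> 'x"
  assumes is_adj: "is_adj X Y T S"
begin

lemma op_closed: "x \<in> hcarrier X \<Longrightarrow> T x \<in> hcarrier Y"
  and adj_closed: "y \<in> hcarrier Y \<Longrightarrow> S y \<in> hcarrier X"
  using is_adj by (auto simp: is_adj_def)

lemma inner_op_left: "x \<in> hcarrier X \<Longrightarrow> y \<in> hcarrier Y \<Longrightarrow> hinner Y (T x) y = hinner X x (S y)"
  using is_adj by (auto simp: is_adj_def)

lemma inner_op_right: "x \<in> hcarrier X \<Longrightarrow> y \<in> hcarrier Y \<Longrightarrow> hinner Y y (T x) = hinner X (S y) x"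
  by (metis inner_op_left X.inner_star Y.inner_star op_closed adj_closed)

lemma flip: "adjoint_pair Y X S T"
  by unfold_locales (auto simp: is_adj_def op_closed adj_closed inner_op_right)

lemma op_add: "x \<in> hcarrier X \<Longrightarrow> y \<in> hcarrier X \<Longrightarrow> T (x + y) = T x + T y"
  by (rule Y.inner_ext)
    (simp_all add: op_closed adj_closed X.closed Y.closed inner_op_right X.inner_add_right Y.inner_add_right)

lemma op_diff: "x \<in> hcarrier X \<Longrightarrow> y \<in> hcarrier X \<Longrightarrow> T (x - y) = T x - T y"
  by (rule Y.inner_ext)
    (simp_all add: op_closed adj_closed X.closed Y.closed inner_op_right X.inner_diff_right Y.inner_diff_right)

lemma op_scaleC: "x \<in> hcarrier X \<Longrightarrow> T (c *\<^sub>C x) = c *\<^sub>C T x"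
  by (rule Y.inner_ext)
    (simp_all add: op_closed adj_closed X.closed Y.closed inner_op_right X.inner_scaleC_right Y.inner_scaleC_right)

lemma op_act: "x \<in> hcarrier X \<Longrightarrow> T (hact X x a) = hact Y (T x) a"
  by (rule Y.inner_ext)
    (simp_all add: op_closed adj_closed X.closed Y.closed inner_op_right X.inner_act_right Y.inner_act_right)

lemma op_zero: "T 0 = 0"
  using op_diff[of 0 0] by (simp add: X.closed)

lemma adj_unique:
  assumes "is_adj X Y T S'" "y \<in> hcarrier Y"
  shows "S' y = S y"
  using assms by (intro X.inner_ext) (auto simp: is_adj_def adj_closed inner_op_left[symmetric])

lemma hnorm_adj_le:
  assumes K: "\<And>x. x \<in> hcarrier X \<Longrightarrow> hnorm Y (T x) \<le> K * hnorm X x" and "0 \<le> K" "y \<in> hcarrier Y"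
  shows "hnorm X (S y) \<le> K * hnorm Y y"
proof (cases "hnorm X (S y) = 0")
  case False
  have "hnorm X (S y) * hnorm X (S y) = norm (hinner Y (T (S y)) y)"
    using X.hnorm_square[of "S y"] assms(3) by (simp add: inner_op_left adj_closed power2_eq_square)
  also have "\<dots> \<le> hnorm Y (T (S y)) * hnorm Y y"
    by (rule Y.norm_inner_le) (simp_all add: op_closed adj_closed assms(3))
  also have "\<dots> \<le> (K * hnorm X (S y)) * hnorm Y y"
    by (intro mult_right_mono K) (simp_all add: adj_closed assms(3))
  finally show ?thesis
    using False X.hnorm_nonneg[of "S y"]
    by (simp add: mult.commute[of K] mult.assoc)
qed (simp add: assms(2))

text \<open>The norm bound becomes an order bound through \<open>R\<close>, which is
  \<open>S \<circ> T\<close> divided by \<open>K * K\<close>: it is a self-adjoint contraction, so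
  \<open>\<langle>x, R x\<rangle>\<close> is dominated by
  \<open>\<langle>x, x\<rangle>\<close>.\<close>

lemma inner_op_le:
  assumes K: "\<And>x. x \<in> hcarrier X \<Longrightarrow> hnorm Y (T x) \<le> K * hnorm X x" and "0 < K" "x \<in> hcarrier X"
  shows "cpos ((K * K) *\<^sub>R hinner X x x - hinner Y (T x) (T x))"
proof -
  define R where "R y = complex_of_real (1 / (K * K)) *\<^sub>C S (T y)" for y
  have inner_R: "hinner X x (R y) = (1 / (K * K)) *\<^sub>R hinner Y (T x) (T y)"
    "hinner X (R x) y = (1 / (K * K)) *\<^sub>R hinner Y (T x) (T y)"
    if "x \<in> hcarrier X" "y \<in> hcarrier X" for x y
    using that adjoint_pair.inner_op_left[OF flip, of "T x" y]
    by (simp_all add: R_def X.inner_scaleC_right X.inner_scaleC_left op_closed adj_closed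
        inner_op_left scaleC_of_real del: of_real_divide of_real_mult)
  have "cpos (hinner X x x - hinner X x (R x))"
  proof (rule X.inner_self_adjoint_contraction_le[OF assms(3)])
    show "R y \<in> hcarrier X" if "y \<in> hcarrier X" for y
      using that by (simp add: R_def X.closed op_closed adj_closed)
    show "hnorm X (R y) \<le> hnorm X y" if y: "y \<in> hcarrier X" for y
    proof -
      have "hnorm X (S (T y)) \<le> K * hnorm Y (T y)"
        by (rule hnorm_adj_le) (use K assms(2) y op_closed in auto)
      also have "\<dots> \<le> K * (K * hnorm X y)"
        by (intro mult_left_mono K) (use assms(2) y in auto)
      finally show ?thesis
        using assms(2) y
        by (simp add: R_def X.hnorm_scaleC op_closed adj_closed norm_divide norm_mult divide_simps mult_ac)
    qed
  qed (simp add: inner_R)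
  then have "cpos ((K * K) *\<^sub>R (hinner X x x - hinner X x (R x)))"
    by (intro cpos_scaleR) simp_all
  then show ?thesis
    using assms(2,3) by (simp add: inner_R scaleR_diff_right)
qed

text \<open>The kernel is the orthogonal complement of the range of \<open>S\<close>, and inner
  products are continuous. This covers domains such as \<open>l2\<close>, for which boundedness of
  \<open>T\<close> is not at hand.\<close>

lemma closed_submodule_kernel: "closed_submodule X {x \<in> hcarrier X. T x = 0}"
  unfolding closed_submodule_def
proof (intro conjI ballI allI impI)
  fix s l assume l: "l \<in> hcarrier X" and s: "\<forall>n. s n \<in> {x \<in> hcarrier X. T x = 0}" and "hlim X s l"
  have "hinner Y z (T l) = 0" if z: "z \<in> hcarrier Y" for z
  proof -
    have "(\<lambda>n. hinner X (S z) (s n)) \<longlonglongrightarrow> hinner X (S z) l"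
      using s by (intro X.hlim_inner l adj_closed z \<open>hlim X s l\<close>) auto
    moreover have "hinner X (S z) (s n) = 0" for n
      using s z inner_op_right[of "s n" z] by (simp add: Y.inner_zero_right)
    ultimately show ?thesis
      using l z by (simp add: inner_op_right LIMSEQ_const_iff)
  qed
  then have "T l = 0"
    by (intro Y.inner_ext) (simp_all add: op_closed l Y.closed Y.inner_zero_right)
  with l show "l \<in> {x \<in> hcarrier X. T x = 0}" by simp
next
  have "hact Y 0 a = 0" for a
    by (rule Y.inner_ext) (simp_all add: Y.closed Y.inner_act_right Y.inner_zero_right)
  then show "hact X x a \<in> {x \<in> hcarrier X. T x = 0}" if "x \<in> {x \<in> hcarrier X. T x = 0}" for x a
    using that by (simp add: X.closed op_act)
qed (auto simp: X.closed op_add op_scaleC op_zero)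

end

section \<open>Consequences of completeness: fixed points, boundedness, invertibility\<close>

lemma (in pre_hilbert_module) hcauchyI:
  assumes s: "\<And>n. s n \<in> hcarrier X" and E: "\<And>n k. hnorm X (s (n + k) - s n) \<le> E n" "E \<longlonglongrightarrow> 0"
  shows "hcauchy X s"
  unfolding hcauchy_def
proof (intro allI impI)
  fix e :: real assume "e > 0"
  then have "\<forall>\<^sub>F n in sequentially. E n < e / 2"
    using order_tendstoD(2)[OF E(2), of "e / 2"] by simp
  then obtain N where N: "E N < e / 2"
    by (auto simp: eventually_sequentially)
  have "hnorm X (s m - s n) < e" if "m \<ge> N" "n \<ge> N" for m n
  proof -
    have "hnorm X (s m - s n) \<le> hnorm X (s m - s N) + hnorm X (s n - s N)"
      using hnorm_triangle_diff[of "s m" "s N" "s n"] hnorm_minus_commute[of "s N" "s n"] s by simp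
    also have "\<dots> \<le> E N + E N"
      using E(1)[of N "m - N"] E(1)[of N "n - N"] that by (intro add_mono) simp_all
    finally show ?thesis using N by simp
  qed
  then show "\<exists>N. \<forall>m\<ge>N. \<forall>n\<ge>N. hnorm X (s m - s n) < e" by blast
qed

lemma (in hilbert_module) contraction_fixpoint:
  assumes G: "\<And>x. x \<in> hcarrier X \<Longrightarrow> G x \<in> hcarrier X"
    and c: "\<And>x y. x \<in> hcarrier X \<Longrightarrow> y \<in> hcarrier X \<Longrightarrow> hnorm X (G x - G y) \<le> c * hnorm X (x - y)"
      "0 \<le> c" "c < 1"
  obtains x where "x \<in> hcarrier X" "G x = x"
proof -
  interpret pre_hilbert_module X by (rule pre_hilbert_module)
  define s where "s n = (G ^^ n) 0" for n
  have s: "s n \<in> hcarrier X" for n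
    by (induction n) (simp_all add: s_def G closed)
  have s_Suc: "s (Suc n) = G (s n)" for n
    by (simp add: s_def)
  define C where "C = hnorm X (s 1 - s 0)"
  have step: "hnorm X (s (Suc n) - s n) \<le> C * c ^ n" for n
  proof (induction n)
    case (Suc n)
    have "hnorm X (s (Suc (Suc n)) - s (Suc n)) \<le> c * hnorm X (s (Suc n) - s n)"
      unfolding s_Suc[of "Suc n"] by (subst (2) s_Suc) (intro c s)
    also have "\<dots> \<le> c * (C * c ^ n)"
      by (intro mult_left_mono Suc c)
    finally show ?case by (simp add: mult_ac)
  qed (simp add: C_def)
  \<comment> \<open>The geometric sum multiplied by \<open>1 - c\<close>; in this form the induction
    step telescopes exactly.\<close>
  have far: "(1 - c) * hnorm X (s (n + k) - s n) \<le> C * (c ^ n - c ^ (n + k))" for n k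
  proof (induction k)
    case 0
    then show ?case using s by (simp add: hnorm_eq_0 closed)
  next
    case (Suc k)
    have "(1 - c) * hnorm X (s (n + Suc k) - s n)
        \<le> (1 - c) * (hnorm X (s (Suc (n + k)) - s (n + k)) + hnorm X (s (n + k) - s n))"
      using hnorm_triangle_diff[of "s (Suc (n + k))" "s (n + k)" "s n"] s c
      by (intro mult_left_mono) simp_all
    also have "\<dots> \<le> (1 - c) * (C * c ^ (n + k)) + C * (c ^ n - c ^ (n + k))"
      unfolding distrib_left using c by (intro add_mono Suc mult_left_mono step) simp_all
    finally show ?case by (simp add: algebra_simps)
  qed
  have "hcauchy X s"
  proof (rule hcauchyI[OF s])
    fix n k
    have "(1 - c) * hnorm X (s (n + k) - s n) \<le> C * c ^ n"
      using far[of n k] c by (simp add: C_def right_diff_distrib) (smt (verit) hnorm_nonneg mult_nonneg_nonneg zero_le_power)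
    then show "hnorm X (s (n + k) - s n) \<le> C / (1 - c) * c ^ n"
      using c by (simp add: field_simps)
    show "(\<lambda>n. C / (1 - c) * c ^ n) \<longlonglongrightarrow> 0"
      using c by (intro tendsto_mult_right_zero LIMSEQ_power_zero) simp
  qed
  then obtain l where l: "l \<in> hcarrier X" "hlim X s l"
    using complete s by blast
  have "hnorm X (G l - l) \<le> c * hnorm X (s n - l) + hnorm X (s (Suc n) - l)" for n
  proof -
    have "hnorm X (G l - l) \<le> hnorm X (G l - s (Suc n)) + hnorm X (s (Suc n) - l)"
      by (intro hnorm_triangle_diff s l G)
    also have "hnorm X (G l - s (Suc n)) \<le> c * hnorm X (s n - l)"
      using c(1)[of l "s n"] s l by (simp add: s_Suc hnorm_minus_commute)
    finally show ?thesis by simp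
  qed
  moreover have "(\<lambda>n. c * hnorm X (s n - l) + hnorm X (s (Suc n) - l)) \<longlonglongrightarrow> c * 0 + 0"
    using l(2) unfolding hlim_def by (intro tendsto_intros LIMSEQ_Suc)
  ultimately have "hnorm X (G l - l) \<le> c * 0 + 0"
    using LIMSEQ_le_const by blast
  then have "hnorm X (G l - l) = 0"
    using hnorm_nonneg[of "G l - l"] by linarith
  then show thesis
    using l G hnorm_eq_0[of "G l - l"] by (intro that[of l]) (auto simp: closed)
qed

context adjoint_pair
begin

text \<open>Uniform boundedness: nested balls on which \<open>T\<close> is ever larger.\<close>

lemma op_bounded:
  assumes "hilbert_module X"
  obtains K where "0 < K" "\<And>x. x \<in> hcarrier X \<Longrightarrow> hnorm Y (T x) \<le> K * hnorm X x"
proof (rule ccontr)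
  note thesis = that
  assume "\<not> thesis"
  then have unbounded: "\<exists>x\<in>hcarrier X. K * hnorm X x < hnorm Y (T x)" if "0 < K" for K
    using thesis[OF that] \<open>\<not> thesis\<close> by (meson not_le)
  \<comment> \<open>A pair is a ball given by centre and radius; \<open>Q\<close> places the second
    ball inside the first.\<close>
  define P where "P n p \<longleftrightarrow> fst p \<in> hcarrier X \<and> 0 < snd p \<and> snd p \<le> 1 / 2 ^ n \<and>
    (\<forall>x\<in>hcarrier X. hnorm X (x - fst p) \<le> snd p \<longrightarrow> real n \<le> hnorm Y (T x))" for n and p :: "'x \<times> real"
  define Q where "Q p q \<longleftrightarrow> hnorm X (fst q - fst p) + snd q \<le> snd p" for p q :: "'x \<times> real"
  have step: "\<exists>q. P (Suc n) q \<and> Q p q" if P: "P n p" for n p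
  proof -
    obtain u r where p: "p = (u, r)" by fastforce
    have u: "u \<in> hcarrier X" and r: "0 < r"
      using P by (auto simp: P_def p)
    \<comment> \<open>The constant is chosen so that \<open>d\<close>, rescaled to length
      \<open>r / 2\<close>, has an image of norm above \<open>n + 2\<close>. One of
      \<open>u + d'\<close> and \<open>u - d'\<close> then inherits this, as their images differ by
      twice that of \<open>d'\<close>.\<close>
    obtain d where d: "d \<in> hcarrier X" "2 * (real n + 2) / r * hnorm X d < hnorm Y (T d)"
      using unbounded[of "2 * (real n + 2) / r"] r by auto
    have "hnorm X d \<noteq> 0"
      using d by (auto simp: X.hnorm_eq_0 op_zero Y.hnorm_eq_0 Y.closed)
    then have hd: "0 < hnorm X d"
      using X.hnorm_nonneg[of d] by linarith
    define d' where "d' = complex_of_real (r / (2 * hnorm X d)) *\<^sub>C d"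
    have d': "d' \<in> hcarrier X" "hnorm X d' = r / 2"
      using d hd r by (simp_all add: d'_def X.closed X.hnorm_scaleC norm_divide norm_mult)
    have Td': "real n + 2 < hnorm Y (T d')"
      using d hd r by (simp add: d'_def op_scaleC Y.hnorm_scaleC op_closed norm_divide norm_mult field_simps)
    have "2 * hnorm Y (T d') = hnorm Y (T (u + d') - T (u - d'))"
    proof -
      have "(u + d') - (u - d') = complex_of_real 2 *\<^sub>C d'"
        using scaleC_add_left[of 1 1 d'] by (simp add: scaleC_one)
      then have "T (u + d') - T (u - d') = complex_of_real 2 *\<^sub>C T d'"
        using u d' by (simp add: op_diff[symmetric] op_scaleC[symmetric] X.closed)
      then show ?thesis
        using d' by (simp add: Y.hnorm_scaleC op_closed)
    qed
    also have "\<dots> \<le> hnorm Y (T (u + d')) + hnorm Y (T (u - d'))"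
      using Y.hnorm_triangle[of "T (u + d')" "- T (u - d')"] u d'
      by (simp add: op_closed X.closed Y.closed Y.hnorm_minus)
    finally have "real n + 2 < hnorm Y (T (u + d')) \<or> real n + 2 < hnorm Y (T (u - d'))"
      using Td' by linarith
    moreover have "hnorm X ((u + d') - u) = r / 2" "hnorm X ((u - d') - u) = r / 2"
      using d' by (simp_all add: X.hnorm_minus)
    ultimately obtain v where v: "v \<in> hcarrier X" "hnorm X (v - u) = r / 2" "real n + 2 < hnorm Y (T v)"
      using u d' X.add_closed X.diff_closed by metis
    define y where "y = T v"
    have y: "y \<in> hcarrier Y" by (simp add: y_def op_closed v)
    have hy: "0 < hnorm Y y" using v(3) by (simp add: y_def)
    \<comment> \<open>The three bounds keep the new ball in the old one, make the centres Cauchy,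
      and give \<open>hnorm X (S y) * r' \<le> hnorm Y y\<close>; the added \<open>1\<close> avoids
      a zero divisor.\<close>
    define r' where "r' = min (r / 2) (min (1 / 2 ^ Suc n) (hnorm Y y / (hnorm X (S y) + 1)))"
    have Sy: "0 < hnorm X (S y) + 1"
      using X.hnorm_nonneg[of "S y"] by linarith
    have r': "0 < r'" "r' \<le> r / 2" "r' \<le> 1 / 2 ^ Suc n" "r' \<le> hnorm Y y / (hnorm X (S y) + 1)"
      using r hy Sy unfolding r'_def
      by (simp, simp_all only: min_le_iff_disj order_refl simp_thms)
    have "hnorm X (S y) * r' \<le> (hnorm X (S y) + 1) * r'"
      using r' by (intro mult_right_mono) simp_all
    also have "\<dots> \<le> hnorm Y y"
      using r'(4) Sy by (simp add: field_simps)
    finally have Syr: "hnorm X (S y) * r' \<le> hnorm Y y" .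
    have "real (Suc n) \<le> hnorm Y (T x)" if x: "x \<in> hcarrier X" "hnorm X (x - v) \<le> r'" for x
    proof -
      \<comment> \<open>Testing \<open>T x\<close> against \<open>y = T v\<close> moves the
        perturbation \<open>x - v\<close> to the side of \<open>S\<close>, where it is controlled.
        The loss is at most \<open>1\<close>, which is why \<open>n + 2\<close> was asked
        for.\<close>
      have "hinner Y y (T x) - hinner X (S y) (x - v) = hinner Y y y"
        using x v y inner_op_right[of v y]
        by (simp add: inner_op_right X.inner_diff_right adj_closed y_def[symmetric])
      then have "hnorm Y y * hnorm Y y \<le> norm (hinner Y y (T x)) + norm (hinner X (S y) (x - v))"
        using norm_triangle_ineq4[of "hinner Y y (T x)" "hinner X (S y) (x - v)"] Y.hnorm_square[of y]
        by (simp add: power2_eq_square)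
      also have "\<dots> \<le> hnorm Y y * hnorm Y (T x) + hnorm X (S y) * hnorm X (x - v)"
        by (intro add_mono X.norm_inner_le Y.norm_inner_le) (simp_all add: x v y op_closed adj_closed X.closed)
      also have "\<dots> \<le> hnorm Y y * hnorm Y (T x) + hnorm Y y"
        using x(2) Syr mult_left_mono[OF x(2), of "hnorm X (S y)"] by simp
      also have "\<dots> = hnorm Y y * (hnorm Y (T x) + 1)"
        by (simp add: distrib_left)
      finally have "hnorm Y y \<le> hnorm Y (T x) + 1"
        using hy by simp
      then show ?thesis
        using v(3) by (simp add: y_def)
    qed
    then have "P (Suc n) (v, r')" "Q p (v, r')"
      using v r' by (auto simp: P_def Q_def p)
    then show ?thesis by blast
  qed
  have "P 0 (0, 1)"
    by (simp add: P_def X.closed)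
  then obtain f where f: "\<And>n. P n (f n)" "\<And>n. Q (f n) (f (Suc n))"
    using dependent_nat_choice[of P "\<lambda>_. Q"] step by blast
  define u r where "u n = fst (f n)" and "r n = snd (f n)" for n
  have u: "u n \<in> hcarrier X" and r: "0 < r n" "r n \<le> 1 / 2 ^ n"
    and large: "\<And>x. x \<in> hcarrier X \<Longrightarrow> hnorm X (x - u n) \<le> r n \<Longrightarrow> real n \<le> hnorm Y (T x)" for n
    using f(1)[of n] by (auto simp: P_def u_def r_def)
  have nested: "hnorm X (u (n + k) - u n) + r (n + k) \<le> r n" for n k
  proof (induction k)
    case 0
    then show ?case by (simp add: X.hnorm_eq_0 X.closed)
  next
    case (Suc k)
    have "hnorm X (u (Suc (n + k)) - u (n + k)) + r (Suc (n + k)) \<le> r (n + k)"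
      using f(2)[of "n + k"] by (simp add: Q_def u_def r_def)
    with Suc show ?case
      using X.hnorm_triangle_diff[of "u (Suc (n + k))" "u (n + k)" "u n"] u by fastforce
  qed
  have near: "hnorm X (u (n + k) - u n) \<le> r n" for n k
    using nested[of n k] r[of "n + k"] by linarith
  have "hcauchy X u"
  proof (rule X.hcauchyI[OF u])
    show "hnorm X (u (n + k) - u n) \<le> 1 / 2 ^ n" for n k
      using near[of n k] r[of n] by linarith
    show "(\<lambda>n. 1 / 2 ^ n :: real) \<longlonglongrightarrow> 0"
      by (rule LIMSEQ_divide_realpow_zero) simp
  qed
  then obtain l where l: "l \<in> hcarrier X" "hlim X u l"
    using hilbert_module.complete[OF assms, of u] u by blast
  have "hnorm X (l - u n) \<le> r n" for n
  proof -
    have "hnorm X (l - u n) \<le> hnorm X (u (n + k) - l) + r n" for k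
      using X.hnorm_triangle_diff[of l "u (n + k)" "u n"] near[of n k] X.hnorm_minus_commute[of l "u (n + k)"] u l
      by fastforce
    moreover have "(\<lambda>k. hnorm X (u (n + k) - l) + r n) \<longlonglongrightarrow> 0 + r n"
      using LIMSEQ_ignore_initial_segment[OF l(2)[unfolded hlim_def], of n]
      by (intro tendsto_intros) (simp add: add.commute)
    ultimately show ?thesis
      using LIMSEQ_le_const[of _ "0 + r n" "hnorm X (l - u n)"] by fastforce
  qed
  then have "real n \<le> hnorm Y (T l)" for n
    using large l by blast
  then show False
    using reals_Archimedean2[of "hnorm Y (T l)"] by (meson not_le)
qed

lemma hnorm_op_le:
  assumes "cpos (B *\<^sub>R hinner X x x - hinner Y (T x) (T x))" "0 \<le> B" "x \<in> hcarrier X"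
  shows "hnorm Y (T x) \<le> sqrt B * hnorm X x"
proof -
  have "norm (hinner Y (T x) (T x)) \<le> norm (B *\<^sub>R hinner X x x)"
    using assms by (intro norm_le_of_cpos_diff Y.inner_pos op_closed)
  then show ?thesis
    using assms(2) by (simp add: hnorm_def real_sqrt_mult[symmetric])
qed

text \<open>For \<open>B\<close> large, \<open>x - S (T x) / B\<close> is a strict contraction, since
  \<open>S T S T \<le> B S T\<close> and \<open>A \<le> S T\<close>.\<close>

lemma adj_op_invertible:
  assumes "hilbert_module X" "0 < A" "0 < B"
    and lower: "\<And>x. x \<in> hcarrier X \<Longrightarrow> cpos (hinner Y (T x) (T x) - A *\<^sub>R hinner X x x)"
    and upper: "\<And>x. x \<in> hcarrier X \<Longrightarrow> cpos (B *\<^sub>R hinner X x x - hinner Y (T x) (T x))"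
  shows "\<exists>R\<in>adjointable X X. \<forall>x\<in>hcarrier X. R (S (T x)) = x \<and> S (T (R x)) = x"
proof -
  \<comment> \<open>The sum is still an upper bound and guarantees \<open>A / C < 1\<close> even for
    the zero module, where \<open>A\<close> may exceed \<open>B\<close>.\<close>
  define C where "C = A + B"
  have C: "0 < C" "0 < A / C" "A / C < 1"
    using assms(2,3) by (simp_all add: C_def)
  then have "C \<noteq> 0" by simp
  have "cpos (C *\<^sub>R hinner X x x - hinner Y (T x) (T x))" if "x \<in> hcarrier X" for x
    using cpos_add[OF upper[OF that] cpos_scaleR[OF _ X.inner_pos[OF that], of A]] assms(2)
    by (simp add: C_def scaleR_add_left algebra_simps)
  then have bound: "hnorm Y (T x) \<le> sqrt C * hnorm X x" if "x \<in> hcarrier X" for x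
    using that C by (intro hnorm_op_le) simp_all
  define D where "D x = x - complex_of_real (1 / C) *\<^sub>C S (T x)" for x
  define c where "c = sqrt (1 - A / C)"
  have c: "0 \<le> c" "c < 1"
    using C by (simp_all add: c_def)
  have D: "D x \<in> hcarrier X" if "x \<in> hcarrier X" for x
    using that by (simp add: D_def X.closed op_closed adj_closed)
  have D_diff: "D (x - y) = D x - D y" if "x \<in> hcarrier X" "y \<in> hcarrier X" for x y
    using that adjoint_pair.op_diff[OF flip, of "T x" "T y"]
    by (simp add: D_def op_diff op_closed scaleC_diff_right)
  have D_le: "hnorm X (D x) \<le> c * hnorm X x" if x: "x \<in> hcarrier X" for x
  proof -
    let ?xx = "hinner X x x" and ?TT = "hinner Y (T x) (T x)" and ?SS = "hinner X (S (T x)) (S (T x))"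
    have "cpos (C *\<^sub>R ?TT - ?SS)"
    proof -
      interpret flip: adjoint_pair Y X S T by (rule flip)
      have "cpos ((sqrt C * sqrt C) *\<^sub>R ?TT - ?SS)"
        using C x by (intro flip.inner_op_le hnorm_adj_le bound) (simp_all add: op_closed)
      then show ?thesis using C by simp
    qed
    \<comment> \<open>The two summands encode that \<open>?TT\<close> dominates
      \<open>A *\<^sub>R ?xx\<close> and that \<open>C *\<^sub>R ?TT\<close> dominates
      \<open>?SS\<close>. Inserted into the expansion of \<open>\<langle>D x, D x\<rangle>\<close>,
      they leave the factor \<open>1 - A / C\<close>.\<close>
    then have pos: "cpos ((1 / C) *\<^sub>R (?TT - A *\<^sub>R ?xx) + (1 / C) *\<^sub>R (1 / C) *\<^sub>R (C *\<^sub>R ?TT - ?SS))"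
      using C by (intro cpos_add cpos_scaleR lower x) simp_all
    have DD: "hinner X (D x) (D x) = ?xx - (1 / C) *\<^sub>R ?TT - (1 / C) *\<^sub>R ?TT + (1 / C) *\<^sub>R (1 / C) *\<^sub>R ?SS"
      using x adjoint_pair.inner_op_left[OF flip, of "T x" x] inner_op_left[of x "T x"]
      by (simp add: D_def X.inner_simps X.closed op_closed adj_closed scaleC_of_real
          scaleR_diff_right del: of_real_divide)
    have "(1 / C) *\<^sub>R (1 / C) *\<^sub>R (C *\<^sub>R ?TT) = (1 / C) *\<^sub>R ?TT"
      using C by simp
    then have "(1 / C) *\<^sub>R (?TT - A *\<^sub>R ?xx) + (1 / C) *\<^sub>R (1 / C) *\<^sub>R (C *\<^sub>R ?TT - ?SS)
        = (1 - A / C) *\<^sub>R ?xx - hinner X (D x) (D x)"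
      unfolding DD by (simp only: scaleR_diff_right) (simp add: scaleR_diff_left)
    with pos have "cpos ((1 - A / C) *\<^sub>R ?xx - hinner X (D x) (D x))"
      by simp
    then have "norm (hinner X (D x) (D x)) \<le> norm ((1 - A / C) *\<^sub>R ?xx)"
      by (intro norm_le_of_cpos_diff X.inner_pos D x)
    then show ?thesis
      using C by (simp add: hnorm_def c_def real_sqrt_mult[symmetric])
  qed
  have "\<exists>x\<in>hcarrier X. S (T x) = y" if y: "y \<in> hcarrier X" for y
  proof -
    \<comment> \<open>A fixed point of \<open>G\<close> is a solution of
      \<open>S (T x) = y\<close>.\<close>
    define G where "G x = D x + complex_of_real (1 / C) *\<^sub>C y" for x
    obtain x where x: "x \<in> hcarrier X" "G x = x"
    proof (rule hilbert_module.contraction_fixpoint[OF assms(1), of G c])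
      show "hnorm X (G x - G z) \<le> c * hnorm X (x - z)" if "x \<in> hcarrier X" "z \<in> hcarrier X" for x z
        using D_le[of "x - z"] that by (simp add: G_def D_diff X.closed)
    qed (use c y in \<open>simp_all add: G_def D X.closed\<close>)
    have "complex_of_real (1 / C) *\<^sub>C S (T x) = complex_of_real (1 / C) *\<^sub>C y"
      using x(2) by (simp add: G_def D_def algebra_simps del: of_real_divide)
    then have "complex_of_real C *\<^sub>C complex_of_real (1 / C) *\<^sub>C S (T x)
        = complex_of_real C *\<^sub>C complex_of_real (1 / C) *\<^sub>C y"
      by simp
    then show ?thesis
      using x(1) C by (auto simp: scaleC_scaleC scaleC_one)
  qed
  then obtain R where R: "\<And>y. y \<in> hcarrier X \<Longrightarrow> R y \<in> hcarrier X" "\<And>y. y \<in> hcarrier X \<Longrightarrow> S (T (R y)) = y"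
    by metis
  have inj: "x = y" if "x \<in> hcarrier X" "y \<in> hcarrier X" "S (T x) = S (T y)" for x y
  proof -
    have "D (x - y) = x - y"
      using that by (simp add: D_diff) (simp add: D_def)
    then have "hnorm X (x - y) \<le> c * hnorm X (x - y)"
      using D_le[of "x - y"] that by (simp add: X.closed)
    then have "(1 - c) * hnorm X (x - y) \<le> 0"
      by (simp add: left_diff_distrib)
    then have "hnorm X (x - y) = 0"
      using c X.hnorm_nonneg[of "x - y"] by (simp add: mult_le_0_iff)
    then show ?thesis
      using that X.hnorm_eq_0[of "x - y"] by (simp add: X.closed)
  qed
  have "hinner X (R x) y = hinner X x (R y)" if "x \<in> hcarrier X" "y \<in> hcarrier X" for x y
    using that inner_op_left[of "R x" "T (R y)"] adjoint_pair.inner_op_left[OF flip, of "T (R x)" "R y"]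
    by (simp add: R op_closed)
  then have "R \<in> adjointable X X"
    using R by (auto simp: adjointable_def is_adj_def intro!: exI[of _ R])
  moreover have "R (S (T x)) = x" if "x \<in> hcarrier X" for x
    using that R by (rule_tac inj) (simp_all add: op_closed adj_closed)
  ultimately show ?thesis
    using R by blast
qed

end

section \<open>Sequences of multipliers\<close>

lemma adjoint_pair_adj:
  assumes "pre_hilbert_module X" "pre_hilbert_module Y" "T \<in> adjointable X Y"
  shows "adjoint_pair X Y T (adj X Y T)"
  using assms is_adj_adj[OF assms(3)] by (intro adjoint_pair.intro adjoint_pair_axioms.intro)

lemma op_inv:
  assumes "R \<in> adjointable X X" "\<And>x. x \<in> hcarrier X \<Longrightarrow> R (T x) = x \<and> T (R x) = x"
  shows "op_inv X T \<in> adjointable X X" "x \<in> hcarrier X \<Longrightarrow> op_inv X T (T x) = x"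
    "x \<in> hcarrier X \<Longrightarrow> T (op_inv X T x) = x"
proof -
  have "\<exists>S. S \<in> adjointable X X \<and> (\<forall>x\<in>hcarrier X. S (T x) = x \<and> T (S x) = x)"
    using assms by blast
  from someI_ex[OF this] show "op_inv X T \<in> adjointable X X" "x \<in> hcarrier X \<Longrightarrow> op_inv X T (T x) = x"
    "x \<in> hcarrier X \<Longrightarrow> T (op_inv X T x) = x"
    by (auto simp: op_inv_def)
qed

text \<open>Membership in the carrier of \<open>l2\<close> is the norm convergence of the frame
  series, so one condition serves frames and outer frames.\<close>

definition frame_bounds :: "('a::cstar_algebra, 'x) hmod \<Rightarrow> (nat \<Rightarrow> 'a \<Rightarrow> 'x) \<Rightarrow> real \<Rightarrow> real \<Rightarrow> bool"
  where "frame_bounds X vs A B \<longleftrightarrow> 0 < A \<and> 0 < B \<and> (\<forall>x\<in>hcarrier X. analysis X vs x \<in> hcarrier l2 \<and>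
    A *\<^sub>R hinner X x x \<preceq> hinner l2 (analysis X vs x) (analysis X vs x) \<and>
    hinner l2 (analysis X vs x) (analysis X vs x) \<preceq> B *\<^sub>R hinner X x x)"

text \<open>Either all multipliers come from \<open>X\<close>, and the inequalities are those of a
  frame, or one does not, and they are those of an outer frame. A dual can thus be constructed
  without knowing which kind it is.\<close>

lemma (in hilbert_module) frame_or_outer_iff:
  "frame_or_outer X vs \<longleftrightarrow> (\<forall>n. vs n \<in> mult_module X) \<and> (\<exists>A B. frame_bounds X vs A B)"
proof -
  have bounds: "(\<exists>A B. frame_bounds X vs A B) \<longleftrightarrow> (\<exists>A>0. \<exists>B>0. \<forall>x\<in>hcarrier X.
       summable (\<lambda>n. star (mult_inner X (vs n) x) * mult_inner X (vs n) x) \<and>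
       A *\<^sub>R hinner X x x \<preceq> (\<Sum>n. star (mult_inner X (vs n) x) * mult_inner X (vs n) x) \<and>
       (\<Sum>n. star (mult_inner X (vs n) x) * mult_inner X (vs n) x) \<preceq> B *\<^sub>R hinner X x x)"
    by (auto simp: frame_bounds_def analysis_def l2_carrier l2_inner)
  have frame: "is_frame X xs \<longleftrightarrow> (\<forall>n. xs n \<in> hcarrier X) \<and> (\<exists>A B. frame_bounds X (\<lambda>n. mult_embed X (xs n)) A B)"
    for xs
  proof (cases "\<forall>n. xs n \<in> hcarrier X")
    case True
    have "(\<exists>A B. frame_bounds X (\<lambda>n. mult_embed X (xs n)) A B) \<longleftrightarrow> (\<exists>A>0. \<exists>B>0. \<forall>x\<in>hcarrier X.
       summable (\<lambda>n. hinner X x (xs n) * hinner X (xs n) x) \<and>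
       A *\<^sub>R hinner X x x \<preceq> (\<Sum>n. hinner X x (xs n) * hinner X (xs n) x) \<and>
       (\<Sum>n. hinner X x (xs n) * hinner X (xs n) x) \<preceq> B *\<^sub>R hinner X x x)"
      using True by (auto simp: frame_bounds_def analysis_def l2_carrier l2_inner mult_inner_embed inner_star)
    then show ?thesis using True by (simp add: is_frame_def)
  qed (auto simp: is_frame_def)
  have embed: "mult_embed X x \<in> mult_module X" if "x \<in> hcarrier X" for x
    using is_adj_mult_embed[OF that] by (auto simp: mult_module_def adjointable_def)
  show ?thesis
  proof (cases "\<exists>xs. (\<forall>n. xs n \<in> hcarrier X) \<and> vs = (\<lambda>n. mult_embed X (xs n))")
    case True
    then obtain xs where xs: "\<And>n. xs n \<in> hcarrier X" "vs = (\<lambda>n. mult_embed X (xs n))" by blast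
    have "frame_or_outer X vs \<longleftrightarrow> (\<exists>ys. is_frame X ys \<and> vs = (\<lambda>n. mult_embed X (ys n)))"
      using xs by (auto simp: frame_or_outer_def is_outer_frame_def)
    also have "\<dots> \<longleftrightarrow> (\<exists>A B. frame_bounds X vs A B)"
    proof
      assume "\<exists>ys. is_frame X ys \<and> vs = (\<lambda>n. mult_embed X (ys n))"
      then obtain ys where "is_frame X ys" "vs = (\<lambda>n. mult_embed X (ys n))" by blast
      then show "\<exists>A B. frame_bounds X vs A B" using frame[of ys] by blast
    next
      assume "\<exists>A B. frame_bounds X vs A B"
      then have "is_frame X xs" using frame[of xs] xs by blast
      then show "\<exists>ys. is_frame X ys \<and> vs = (\<lambda>n. mult_embed X (ys n))" using xs(2) by blast
    qed
    finally show ?thesis using xs embed by simp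
  next
    case False
    have outer: "\<exists>n. vs n \<notin> mult_embed X ` hcarrier X"
    proof (rule ccontr)
      assume "\<nexists>n. vs n \<notin> mult_embed X ` hcarrier X"
      then have "\<forall>n. \<exists>x. x \<in> hcarrier X \<and> vs n = mult_embed X x" by blast
      then obtain xs where "\<forall>n. xs n \<in> hcarrier X \<and> vs n = mult_embed X (xs n)" by metis
      with False show False by auto
    qed
    have "frame_or_outer X vs \<longleftrightarrow> is_outer_frame X vs"
      using False by (auto simp: frame_or_outer_def is_frame_def)
    also have "\<dots> \<longleftrightarrow> (\<forall>n. vs n \<in> mult_module X) \<and> (\<exists>A B. frame_bounds X vs A B)"
      unfolding is_outer_frame_def bounds using outer by blast
    finally show ?thesis .
  qed
qed

lemma (in hilbert_module) adjoint_pair_multiplier: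
  assumes "v \<in> mult_module X"
  shows "adjoint_pair cstar_mod X v (mult_inner X v)"
proof -
  have "mult_inner X v = adj cstar_mod X v"
    by (rule ext) (simp add: mult_inner_def)
  then show ?thesis
    using adjoint_pair_adj[OF pre_hilbert_module_cstar_mod pre_hilbert_module] assms
    by (simp add: mult_module_def)
qed

locale multiplier_sequence = hilbert_module X
  for X :: "('a::cstar_algebra, 'x::complex_vector) hmod" +
  fixes vs :: "nat \<Rightarrow> 'a \<Rightarrow> 'x"
  assumes vs: "vs n \<in> mult_module X"
begin

sublocale pre: pre_hilbert_module X
  by (rule pre_hilbert_module)

lemma multiplier_closed: "vs n a \<in> hcarrier X"
  using adjoint_pair.op_closed[OF adjoint_pair_multiplier[OF vs], of a n] by (simp add: cstar_mod_def)

lemma inner_multiplier: "x \<in> hcarrier X \<Longrightarrow> hinner X x (vs n a) = star (mult_inner X (vs n) x) * a"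
  using adjoint_pair.inner_op_right[OF adjoint_pair_multiplier[OF vs], of a x n] by (simp add: cstar_mod_def)

lemma synthesis_closed: "(\<Sum>n<N. vs n (a n)) \<in> hcarrier X"
  by (intro pre.sum_closed multiplier_closed)

lemma inner_synthesis:
  assumes "x \<in> hcarrier X"
  shows "hinner X x (\<Sum>n<N. vs n (a n)) = hinner l2 (analysis X vs x) (l2_trunc N a)"
  using assms by (simp add: pre.inner_sum_right multiplier_closed inner_multiplier l2_inner_trunc analysis_def)

text \<open>The adjoint is the synthesis operator. Its partial sums pair with \<open>x\<close> as
  the truncations of \<open>a\<close> do with \<open>analysis X vs x\<close>, so the upper frame
  bound makes them Cauchy, and completeness of \<open>X\<close> supplies the limit.\<close>

lemma adjointable_analysis:
  assumes fb: "frame_bounds X vs A B"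
  shows "analysis X vs \<in> adjointable X l2"
proof -
  let ?U = "analysis X vs"
  have B: "0 < B" and U: "?U x \<in> hcarrier l2" and upper: "hnorm l2 (?U x) \<le> sqrt B * hnorm X x"
    if "x \<in> hcarrier X" for x
  proof -
    show "0 < B" "?U x \<in> hcarrier l2"
      using fb that by (auto simp: frame_bounds_def)
    have "norm (hinner l2 (?U x) (?U x)) \<le> norm (B *\<^sub>R hinner X x x)"
      using fb that by (intro norm_le_of_cpos_diff l2.inner_pos) (auto simp: frame_bounds_def cle_def)
    then show "hnorm l2 (?U x) \<le> sqrt B * hnorm X x"
      using \<open>0 < B\<close> by (simp add: hnorm_def real_sqrt_mult[symmetric])
  qed
  have "\<exists>l\<in>hcarrier X. \<forall>x\<in>hcarrier X. hinner l2 (?U x) a = hinner X x l" if a: "a \<in> hcarrier l2" for a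
  proof -
    define s where "s N = (\<Sum>n<N. vs n (a n))" for N
    have s: "s N \<in> hcarrier X" for N
      by (simp add: s_def synthesis_closed)
    have s_diff: "hnorm X (s m - s n) \<le> sqrt B * hnorm l2 (l2_trunc m a - l2_trunc n a)" for m n
    proof (cases "hnorm X (s m - s n) = 0")
      case False
      let ?d = "s m - s n"
      have d: "?d \<in> hcarrier X" by (simp add: pre.closed s)
      have "hnorm X ?d * hnorm X ?d = norm (hinner l2 (?U ?d) (l2_trunc m a - l2_trunc n a))"
        using pre.hnorm_square[of ?d] d s
        by (simp add: power2_eq_square pre.inner_diff_right l2.inner_diff_right U l2_trunc_closed)
          (simp add: s_def inner_synthesis)
      also have "\<dots> \<le> hnorm l2 (?U ?d) * hnorm l2 (l2_trunc m a - l2_trunc n a)"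
        by (intro l2.norm_inner_le) (simp_all add: U d l2.closed l2_trunc_closed)
      also have "\<dots> \<le> (sqrt B * hnorm X ?d) * hnorm l2 (l2_trunc m a - l2_trunc n a)"
        by (intro mult_right_mono upper d) simp
      finally show ?thesis
        using False pre.hnorm_nonneg[of ?d] by (simp add: mult.commute[of "sqrt B"] mult.assoc)
    next
      case True
      then show ?thesis using B[OF s] by simp
    qed
    have lim: "(\<lambda>n. sqrt B * hnorm l2 (l2_trunc n a - a)) \<longlonglongrightarrow> 0"
      using hlim_l2_trunc[OF a] unfolding hlim_def by (rule tendsto_mult_right_zero)
    have "hcauchy X s"
      unfolding hcauchy_def
    proof (intro allI impI)
      fix e :: real assume "e > 0"
      then have "\<forall>\<^sub>F n in sequentially. sqrt B * hnorm l2 (l2_trunc n a - a) < e / 2"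
        using order_tendstoD(2)[OF lim, of "e / 2"] by simp
      then obtain N where N: "\<And>n. n \<ge> N \<Longrightarrow> sqrt B * hnorm l2 (l2_trunc n a - a) < e / 2"
        by (auto simp: eventually_sequentially)
      have "hnorm X (s m - s n) < e" if "m \<ge> N" "n \<ge> N" for m n
      proof -
        have "hnorm l2 (l2_trunc m a - l2_trunc n a) \<le> hnorm l2 (l2_trunc m a - a) + hnorm l2 (l2_trunc n a - a)"
          using l2.hnorm_triangle_diff[of "l2_trunc m a" a "l2_trunc n a"]
            l2.hnorm_minus_commute[of a "l2_trunc n a"] a by (simp add: l2_trunc_closed)
        then have "sqrt B * hnorm l2 (l2_trunc m a - l2_trunc n a)
            \<le> sqrt B * hnorm l2 (l2_trunc m a - a) + sqrt B * hnorm l2 (l2_trunc n a - a)"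
          using B[OF s] by (simp add: distrib_left[symmetric])
        then show ?thesis
          using s_diff[of m n] N[OF that(1)] N[OF that(2)] by linarith
      qed
      then show "\<exists>N. \<forall>m\<ge>N. \<forall>n\<ge>N. hnorm X (s m - s n) < e" by blast
    qed
    then obtain l where l: "l \<in> hcarrier X" "hlim X s l"
      using complete s by blast
    have "hinner l2 (?U x) a = hinner X x l" if x: "x \<in> hcarrier X" for x
    proof (rule LIMSEQ_unique)
      show "(\<lambda>n. hinner X x (s n)) \<longlonglongrightarrow> hinner X x l"
        by (intro pre.hlim_inner s l x)
      show "(\<lambda>n. hinner X x (s n)) \<longlonglongrightarrow> hinner l2 (?U x) a"
        unfolding s_def inner_synthesis[OF x]
        by (intro l2.hlim_inner hlim_l2_trunc l2_trunc_closed U x a)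
    qed
    with l show ?thesis by blast
  qed
  then obtain S where "\<And>a. a \<in> hcarrier l2 \<Longrightarrow> S a \<in> hcarrier X"
    "\<And>a x. a \<in> hcarrier l2 \<Longrightarrow> x \<in> hcarrier X \<Longrightarrow> hinner l2 (?U x) a = hinner X x (S a)"
    by metis
  then have "is_adj X l2 ?U S"
    using U by (auto simp: is_adj_def)
  then show ?thesis by (auto simp: adjointable_def)
qed

end

text \<open>Every adjointable operator into the standard module is an analysis operator: its \<open>n\<close>-th
  coordinate is the adjoint of the multiplier \<open>V\<^sup>* e\<^sub>n\<close>.\<close>

lemma (in hilbert_module) analysis_of_adjointable:
  assumes "adjoint_pair X l2 V S"
  defines "ys \<equiv> \<lambda>n a. S (l2_single n a)"
  shows "multiplier_sequence X ys" and "x \<in> hcarrier X \<Longrightarrow> analysis X ys x = V x"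
proof -
  interpret V: adjoint_pair X l2 V S by fact
  have adj: "is_adj cstar_mod X (ys n) (\<lambda>x. V x n)" for n
    using adjoint_pair.inner_op_left[OF V.flip]
    by (auto simp: is_adj_def cstar_mod_def ys_def V.adj_closed l2_single_closed l2_inner_single)
  then have ys: "ys n \<in> mult_module X" for n
    by (auto simp: mult_module_def adjointable_def)
  then show "multiplier_sequence X ys"
    by unfold_locales
  show "analysis X ys x = V x" if x: "x \<in> hcarrier X"
  proof
    fix n
    show "analysis X ys x n = V x n"
      using adjoint_pair.adj_unique[OF adjoint_pair_multiplier[OF ys] adj x] by (simp add: analysis_def)
  qed
qed

section \<open>Duality and oblique projections\<close>

text \<open>\<open>U \<circ> V'\<close> has the adjoint \<open>V \<circ> U'\<close>, and its range
  is the kernel of the complementary idempotent; as kernels of adjointable operators, both summands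
  are closed.\<close>

lemma oblique_projection_of_left_inverse:
  assumes "adjoint_pair X H U U'" "adjoint_pair X H V V'"
    and inv: "\<And>x. x \<in> hcarrier X \<Longrightarrow> V' (U x) = x"
  shows "oblique_projection H (U ` hcarrier X) {a \<in> hcarrier H. U (V' a) = 0} (\<lambda>a. U (V' a))"
proof -
  interpret U: adjoint_pair X H U U' by fact
  interpret V: adjoint_pair X H V V' by fact
  let ?F = "\<lambda>a. U (V' a)" and ?G = "\<lambda>a. V (U' a)"
  have F_inner: "hinner H (?F a) b = hinner H a (?G b)" if "a \<in> hcarrier H" "b \<in> hcarrier H" for a b
    using that by (simp add: U.inner_op_left V.inner_op_right U.adj_closed V.adj_closed)
  interpret F: adjoint_pair H H ?F ?G
    by unfold_locales (auto simp: is_adj_def U.op_closed V.op_closed U.adj_closed V.adj_closed F_inner)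
  interpret I: adjoint_pair H H "\<lambda>a. a - ?F a" "\<lambda>a. a - ?G a"
    by unfold_locales
      (auto simp: is_adj_def U.Y.closed F.op_closed F.adj_closed U.Y.inner_diff_left U.Y.inner_diff_right F_inner)
  have range: "U ` hcarrier X = {a \<in> hcarrier H. a - ?F a = 0}"
  proof (intro equalityI subsetI)
    fix a assume "a \<in> U ` hcarrier X"
    then show "a \<in> {a \<in> hcarrier H. a - ?F a = 0}"
      by (auto simp: U.op_closed inv)
  next
    fix a assume "a \<in> {a \<in> hcarrier H. a - ?F a = 0}"
    then show "a \<in> U ` hcarrier X"
      using V.adj_closed by auto
  qed
  show ?thesis
    unfolding oblique_projection_def
  proof (intro conjI)
    show "closed_submodule H (U ` hcarrier X)"
      unfolding range by (rule I.closed_submodule_kernel)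
    show "closed_submodule H {a \<in> hcarrier H. ?F a = 0}"
      by (rule F.closed_submodule_kernel)
    show "U ` hcarrier X \<inter> {a \<in> hcarrier H. ?F a = 0} = {0}"
      unfolding range by (auto simp: U.Y.closed F.op_zero)
    show "\<forall>y\<in>U ` hcarrier X. \<forall>z\<in>{a \<in> hcarrier H. ?F a = 0}. ?F (y + z) = y"
      unfolding range by (auto simp: F.op_add)
    have ex: "\<exists>y\<in>U ` hcarrier X. \<exists>z\<in>{a \<in> hcarrier H. ?F a = 0}. a = y + z" if a: "a \<in> hcarrier H" for a
    proof (intro bexI)
      show "a = ?F a + (a - ?F a)" by simp
      show "a - ?F a \<in> {a \<in> hcarrier H. ?F a = 0}"
        using a by (simp add: U.Y.closed F.op_closed F.op_diff inv V.adj_closed)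
      show "?F a \<in> U ` hcarrier X"
        using a V.adj_closed by blast
    qed
    show "hcarrier H = {y + z |y z. y \<in> U ` hcarrier X \<and> z \<in> {a \<in> hcarrier H. ?F a = 0}}"
    proof (intro equalityI subsetI)
      fix a assume "a \<in> hcarrier H"
      from ex[OF this] show "a \<in> {y + z |y z. y \<in> U ` hcarrier X \<and> z \<in> {a \<in> hcarrier H. ?F a = 0}}"
        by blast
    qed (auto intro!: U.Y.add_closed U.op_closed)
  qed
qed

theorem theorem4p14:
  fixes X :: "('a::cstar_algebra, 'x::complex_vector) hmod"
    and xs :: "nat \<Rightarrow> 'a \<Rightarrow> 'x"
    and U V :: "'x \<Rightarrow> nat \<Rightarrow> 'a"
  assumes "hilbert_module X"
    and "frame_or_outer X xs"
    and U: "U = analysis X xs"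
    and "V \<in> adjointable X l2"
  shows "(\<exists>ys. frame_or_outer X ys \<and> dual_to X ys xs \<and>
             (\<forall>x\<in>hcarrier X. V x = analysis X ys x))
     \<longleftrightarrow> (\<exists>F\<in>adjointable l2 l2.
             (\<exists>Z. oblique_projection l2 (U ` hcarrier X) Z F) \<and>
             (\<forall>x\<in>hcarrier X. V x = adj l2 l2 F (U (op_inv X (adj X l2 U \<circ> U) x))))"
proof -
  interpret hilbert_module X by fact
  obtain A B where fb: "frame_bounds X xs A B" and "\<And>n. xs n \<in> mult_module X"
    using assms(2) unfolding frame_or_outer_iff by blast
  then interpret xs: multiplier_sequence X xs
    by unfold_locales
  define U' where "U' = adj X l2 U"
  interpret U: adjoint_pair X l2 U U'
    unfolding U'_def U
    by (rule adjoint_pair_adj[OF pre_hilbert_module pre_hilbert_module_l2 xs.adjointable_analysis[OF fb]])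
  define V' where "V' = adj X l2 V"
  interpret V: adjoint_pair X l2 V V'
    unfolding V'_def by (rule adjoint_pair_adj[OF pre_hilbert_module pre_hilbert_module_l2 assms(4)])
  define R where "R = op_inv X (U' \<circ> U)"
  have AB: "0 < A" "0 < B"
    and lower: "cpos (hinner l2 (U x) (U x) - A *\<^sub>R hinner X x x)"
    and upper: "cpos (B *\<^sub>R hinner X x x - hinner l2 (U x) (U x))" if "x \<in> hcarrier X" for x
    using fb that by (auto simp: frame_bounds_def cle_def U)
  \<comment> \<open>\<open>op_inv\<close> is a choice, so an inverse has to be exhibited before
    anything is known about \<open>R\<close>.\<close>
  obtain Q where Q: "Q \<in> adjointable X X" "\<And>x. x \<in> hcarrier X \<Longrightarrow> Q (U' (U x)) = x \<and> U' (U (Q x)) = x"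
    using U.adj_op_invertible[OF assms(1) AB[OF zero_closed] lower upper] by blast
  have "R \<in> adjointable X X" and R: "\<And>x. x \<in> hcarrier X \<Longrightarrow> R (U' (U x)) = x"
    "\<And>x. x \<in> hcarrier X \<Longrightarrow> U' (U (R x)) = x"
    using op_inv[OF Q(1), of "U' \<circ> U"] Q(2) unfolding R_def by auto
  then have R_closed: "R x \<in> hcarrier X" if "x \<in> hcarrier X" for x
    using that by (auto simp: adjointable_def is_adj_def)
  show ?thesis
    unfolding U'_def[symmetric] R_def[symmetric]
  proof
    assume "\<exists>ys. frame_or_outer X ys \<and> dual_to X ys xs \<and> (\<forall>x\<in>hcarrier X. V x = analysis X ys x)"
    then obtain ys where ys: "frame_or_outer X ys" "dual_to X ys xs"
      "\<And>x. x \<in> hcarrier X \<Longrightarrow> V x = analysis X ys x"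
      by blast
    interpret ys: multiplier_sequence X ys
      using ys(1) unfolding frame_or_outer_iff by unfold_locales blast
    \<comment> \<open>The partial sums of the duality series converge to \<open>x\<close> by
      assumption, while their inner products with \<open>z\<close> converge to
      \<open>\<langle>V z, U x\<rangle>\<close>.\<close>
    have inv: "V' (U x) = x" if x: "x \<in> hcarrier X" for x
    proof (rule xs.pre.inner_ext)
      fix z assume z: "z \<in> hcarrier X"
      let ?s = "\<lambda>N. \<Sum>n<N. ys n (U x n)"
      have "(\<lambda>N. hinner X z (?s N)) \<longlonglongrightarrow> hinner X z x"
        using ys(2) x z
        by (intro xs.pre.hlim_inner ys.synthesis_closed) (auto simp: dual_to_def U analysis_def)
      moreover have "(\<lambda>N. hinner X z (?s N)) \<longlonglongrightarrow> hinner l2 (V z) (U x)"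
        unfolding ys.inner_synthesis[OF z] ys(3)[OF z, symmetric]
        by (intro l2.hlim_inner hlim_l2_trunc l2_trunc_closed V.op_closed U.op_closed x z)
      ultimately show "hinner X z (V' (U x)) = hinner X z x"
        using x z by (simp add: V.inner_op_left[symmetric] U.op_closed LIMSEQ_unique)
    qed (simp_all add: x V.adj_closed U.op_closed)
    define F where "F a = U (V' a)" for a
    have adj_F: "is_adj l2 l2 F (\<lambda>a. V (U' a))"
      by (auto simp: is_adj_def F_def U.op_closed V.op_closed U.adj_closed V.adj_closed
          U.inner_op_left V.inner_op_right)
    then have F: "F \<in> adjointable l2 l2"
      by (auto simp: adjointable_def)
    have "V x = adj l2 l2 F (U (R x))" if x: "x \<in> hcarrier X" for x
    proof -
      have "adj l2 l2 F (U (R x)) = V (U' (U (R x)))"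
        using adjoint_pair.adj_unique[OF adjoint_pair_adj[OF pre_hilbert_module_l2 pre_hilbert_module_l2 F] adj_F]
        by (simp add: U.op_closed R_closed x)
      then show ?thesis using R x by simp
    qed
    moreover have "oblique_projection l2 (U ` hcarrier X) {a \<in> hcarrier l2. U (V' a) = 0} F"
      unfolding F_def[abs_def]
      by (rule oblique_projection_of_left_inverse[OF U.adjoint_pair_axioms V.adjoint_pair_axioms]) (rule inv)
    ultimately show "\<exists>F\<in>adjointable l2 l2. (\<exists>Z. oblique_projection l2 (U ` hcarrier X) Z F) \<and>
        (\<forall>x\<in>hcarrier X. V x = adj l2 l2 F (U (R x)))"
      using F by blast
  next
    assume "\<exists>F\<in>adjointable l2 l2. (\<exists>Z. oblique_projection l2 (U ` hcarrier X) Z F) \<and>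
        (\<forall>x\<in>hcarrier X. V x = adj l2 l2 F (U (R x)))"
    then obtain F Z where F: "F \<in> adjointable l2 l2" "oblique_projection l2 (U ` hcarrier X) Z F"
      and VF: "\<And>x. x \<in> hcarrier X \<Longrightarrow> V x = adj l2 l2 F (U (R x))"
      by blast
    interpret F: adjoint_pair l2 l2 F "adj l2 l2 F"
      by (rule adjoint_pair_adj[OF pre_hilbert_module_l2 pre_hilbert_module_l2 F(1)])
    have FU: "F (U x) = U x" if "x \<in> hcarrier X" for x
    proof -
      have "0 \<in> Z" "\<forall>y\<in>U ` hcarrier X. \<forall>z\<in>Z. F (y + z) = y"
        using F(2) by (auto simp: oblique_projection_def closed_submodule_def)
      \<comment> \<open>The component of \<open>U x\<close> in \<open>Z\<close> is
        \<open>0\<close>.\<close>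
      then have "F (U x + 0) = U x"
        using that by blast
      then show ?thesis by simp
    qed
    \<comment> \<open>\<open>F\<close> passes to the right of the inner product and fixes
      \<open>U x\<close>; what remains is \<open>U' (U (R z)) = z\<close>.\<close>
    have VU: "hinner l2 (V z) (U x) = hinner X z x" if x: "x \<in> hcarrier X" and z: "z \<in> hcarrier X" for x z
    proof -
      have "hinner l2 (V z) (U x) = hinner l2 (U (R z)) (F (U x))"
        using x z by (simp add: VF F.inner_op_right U.op_closed R_closed)
      also have "\<dots> = hinner X (U' (U (R z))) x"
        using x z by (simp add: FU U.inner_op_right U.op_closed R_closed)
      finally show ?thesis using R z by simp
    qed
    have V'U: "V' (U x) = x" if x: "x \<in> hcarrier X" for x
      using x by (intro xs.pre.inner_ext) (simp_all add: V.inner_op_left[symmetric] VU U.op_closed V.adj_closed)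
    have U'V: "U' (V x) = x" if x: "x \<in> hcarrier X" for x
    proof (rule xs.pre.inner_ext)
      fix z assume z: "z \<in> hcarrier X"
      have "hinner X z (U' (V x)) = star (hinner l2 (V x) (U z))"
        using x z by (simp add: U.inner_op_left[symmetric] l2.inner_star U.op_closed V.op_closed)
      also have "\<dots> = hinner X z x"
        using x z by (simp add: VU xs.pre.inner_star)
      finally show "hinner X z (U' (V x)) = hinner X z x" .
    qed (simp_all add: x V.op_closed U.adj_closed)
    obtain K where K: "0 < K" "\<And>x. x \<in> hcarrier X \<Longrightarrow> hnorm l2 (V x) \<le> K * hnorm X x"
      using V.op_bounded[OF assms(1)] by blast
    obtain M where M: "0 < M" "\<And>x. x \<in> hcarrier X \<Longrightarrow> hnorm l2 (U x) \<le> M * hnorm X x"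
      using U.op_bounded[OF assms(1)] by blast
    define ys where "ys n a = V' (l2_single n a)" for n a
    interpret ys: multiplier_sequence X ys
      unfolding ys_def[abs_def] by (rule analysis_of_adjointable(1)[OF V.adjoint_pair_axioms])
    have V_ys: "analysis X ys x = V x" if "x \<in> hcarrier X" for x
      unfolding ys_def[abs_def] by (rule analysis_of_adjointable(2)[OF V.adjoint_pair_axioms that])
    \<comment> \<open>\<open>K\<close> bounds \<open>V\<close>, and \<open>M\<close> bounds
      \<open>U\<close> and therefore its adjoint \<open>U'\<close>, which maps \<open>V x\<close>
      back to \<open>x\<close>.\<close>
    have "frame_bounds X ys (1 / (M * M)) (K * K)"
      unfolding frame_bounds_def cle_def
    proof (intro conjI ballI)
      fix x assume x: "x \<in> hcarrier X"
      show "analysis X ys x \<in> hcarrier l2"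
        using x by (simp add: V_ys V.op_closed)
      show "cpos ((K * K) *\<^sub>R hinner X x x - hinner l2 (analysis X ys x) (analysis X ys x))"
        using V.inner_op_le[OF K(2) K(1) x] x by (simp add: V_ys)
      interpret flip: adjoint_pair l2 X U' U by (rule U.flip)
      have "cpos ((M * M) *\<^sub>R hinner l2 (V x) (V x) - hinner X (U' (V x)) (U' (V x)))"
        by (intro flip.inner_op_le U.hnorm_adj_le M) (use M x in \<open>auto simp: V.op_closed\<close>)
      then have "cpos ((1 / (M * M)) *\<^sub>R ((M * M) *\<^sub>R hinner l2 (V x) (V x) - hinner X x x))"
        using x by (intro cpos_scaleR) (simp_all add: U'V)
      then show "cpos (hinner l2 (analysis X ys x) (analysis X ys x) - (1 / (M * M)) *\<^sub>R hinner X x x)"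
        using x M(1) by (simp add: V_ys scaleR_diff_right)
    qed (use K M in simp_all)
    then have "frame_or_outer X ys"
      unfolding frame_or_outer_iff using ys.vs by blast
    moreover have "dual_to X ys xs"
      unfolding dual_to_def hlim_def
    proof
      fix x assume x: "x \<in> hcarrier X"
      \<comment> \<open>The partial sums are \<open>V'\<close> applied to truncations of
        \<open>U x\<close>, and \<open>V'\<close> inherits the bound \<open>K\<close> from
        \<open>V\<close>; so they converge to \<open>V' (U x) = x\<close>.\<close>
      have s: "(\<Sum>n<N. ys n (mult_inner X (xs n) x)) = V' (l2_trunc N (U x))" for N
      proof (rule xs.pre.inner_ext)
        fix z assume z: "z \<in> hcarrier X"
        then show "hinner X z (\<Sum>n<N. ys n (mult_inner X (xs n) x)) = hinner X z (V' (l2_trunc N (U x)))"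
          using ys.inner_synthesis[OF z, where N = N and a = "U x"]
          by (simp add: V_ys V.inner_op_left[symmetric] l2_trunc_closed) (simp add: U analysis_def)
      qed (simp_all add: ys.synthesis_closed V.adj_closed l2_trunc_closed)
      show "(\<lambda>N. hnorm X ((\<Sum>n<N. ys n (mult_inner X (xs n) x)) - x)) \<longlonglongrightarrow> 0"
      proof (rule Lim_null_comparison)
        have "hnorm X (V' (l2_trunc N (U x)) - x) \<le> K * hnorm l2 (l2_trunc N (U x) - U x)" for N
        proof -
          have "V' (l2_trunc N (U x)) - x = V' (l2_trunc N (U x) - U x)"
            using x adjoint_pair.op_diff[OF V.flip, of "l2_trunc N (U x)" "U x"]
            by (simp add: l2_trunc_closed U.op_closed V'U)
          then show ?thesis
            using V.hnorm_adj_le[OF K(2), of "l2_trunc N (U x) - U x"] K(1) x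
            by (simp add: l2.closed l2_trunc_closed U.op_closed)
        qed
        then show "\<forall>\<^sub>F N in sequentially. norm (hnorm X ((\<Sum>n<N. ys n (mult_inner X (xs n) x)) - x))
            \<le> K * hnorm l2 (l2_trunc N (U x) - U x)"
          by (simp add: s)
        show "(\<lambda>N. K * hnorm l2 (l2_trunc N (U x) - U x)) \<longlonglongrightarrow> 0"
          using hlim_l2_trunc[OF U.op_closed[OF x]] unfolding hlim_def by (rule tendsto_mult_right_zero)
      qed
    qed
    ultimately show "\<exists>ys. frame_or_outer X ys \<and> dual_to X ys xs \<and> (\<forall>x\<in>hcarrier X. V x = analysis X ys x)"
      using V_ys by force
  qed
qed

end
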